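(* Let $n\ge 3$ and $I\subseteq[0,n-1]$. Then there exists a polynomial $M_I(x)\in\mathbb{Z}[x]$ such that $$\mathcal{D}_n^I(x)=M_I(x)\prod_{j=2m_I+2}^n\left(1+(-1)^{j-1}x^{\left\lfloor\frac{j}{2}\right\rfloor}\right)^2.$$
   Context: For integers $a\le b$ let $[a,b]=\{a,a+1,\dots,b\}$, and $[a,b]=\emptyset$ if $a>b$; $[n]=[1,n]$. A signed permutation of degree $n$ is a bijection $\sigma$ of $\{\pm1,\dots,\pm n\}$ with $\sigma(-i)=-\sigma(i)$; $\mathcal{D}_n$ is the group of signed permutations of degree $n$ with an even number of negative entries among $\sigma(1),\dots,\sigma(n)$. For $\sigma\in\mathcal{D}_n$, the Coxeter length is $\ell(\sigma)=|\{(i,j)\in[n]^2: i<j,\ \sigma(i)>\sigma(j)\}|+|\{(i,j)\in[n]^2: i<j,\ \sigma(i)+\sigma(j)<0\}|$, and the odd length is $L(\sigma)=|\{(i,j)\in[n]^2: i<j,\ \sigma(i)>\sigma(j),\ i\not\equiv j\ (\mathrm{mod}\ 2)\}|+|\{(i,j)\in[n]^2: i<j,\ \sigma(i)+\sigma(j)<0,\ i\not\equiv j\ (\mathrm{mod}\ 2)\}|$. For $I\subseteq[0,n-1]$, $\mathcal{D}_n^I=\{\sigma\in\mathcal{D}_n:\sigma(i)<\sigma(i+1)\text{ for all } i\in I\}$ with the convention $\sigma(0):=-\sigma(2)$, and $\mathcal{D}_n^I(x)=\sum_{\sigma\in\mathcal{D}_n^I}(-1)^{\ell(\sigma)}x^{L(\sigma)}$.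 Connected components: each $I\subseteq[0,n-1]$ is uniquely $I=I_0\cup I_1\cup\cdots\cup I_s$, where $I_0=[0,a_0-1]$ is the maximal interval of $I$ containing $0$ (with $I_0=\emptyset$ if $0\notin I$), and $I_1,\dots,I_s$ are the other maximal intervals of consecutive integers in $I$. Set $m_I=\sum_{k=0}^s\left\lfloor\frac{|I_k|+1}{2}\right\rfloor$. Empty products equal $1$. *)

theory Defs
  imports "HOL-Combinatorics.Permutations" "HOL-Computational_Algebra.Polynomial"
begin

text \<open>
  A signed permutation of degree \<open>n\<close> is a function on all integers that permutes
  \<open>{\<plusminus>1, \<dots>, \<plusminus>n}\<close> and, following the library convention for \<^const>\<open>permutes\<close>, is the identity
  elsewhere. In particular \<open>\<sigma> 0 = 0\<close> as a function; the different convention for the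
  entry at position \<open>0\<close> is introduced by \<open>entryD\<close> below.
\<close>

definition signed_perms :: "nat \<Rightarrow> (int \<Rightarrow> int) set" where
  "signed_perms n =
     {\<sigma>. \<sigma> permutes ({- int n..int n} - {0}) \<and>
         (\<forall>i \<in> {- int n..int n} - {0}. \<sigma> (- i) = - \<sigma> i)}"

definition even_signed_perms :: "nat \<Rightarrow> (int \<Rightarrow> int) set" where
  "even_signed_perms n =
     {\<sigma> \<in> signed_perms n. even (card {i \<in> {1..n}. \<sigma> (int i) < 0})}"

definition lengthD :: "nat \<Rightarrow> (int \<Rightarrow> int) \<Rightarrow> nat" where
  "lengthD n \<sigma> =
     card {(i, j) \<in> {1..n} \<times> {1..n}. i < j \<and> \<sigma> (int i) > \<sigma> (int j)} +
     card {(i, j) \<in> {1..n} \<times> {1..n}. i < j \<and> \<sigma> (int i) + \<sigma> (int j) < 0}"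

definition odd_lengthD :: "nat \<Rightarrow> (int \<Rightarrow> int) \<Rightarrow> nat" where
  "odd_lengthD n \<sigma> =
     card {(i, j) \<in> {1..n} \<times> {1..n}.
             i < j \<and> \<sigma> (int i) > \<sigma> (int j) \<and> i mod 2 \<noteq> j mod 2} +
     card {(i, j) \<in> {1..n} \<times> {1..n}.
             i < j \<and> \<sigma> (int i) + \<sigma> (int j) < 0 \<and> i mod 2 \<noteq> j mod 2}"

definition entryD :: "(int \<Rightarrow> int) \<Rightarrow> nat \<Rightarrow> int" where
  "entryD \<sigma> i = (if i = 0 then - \<sigma> 2 else \<sigma> (int i))"

definition quotientD :: "nat \<Rightarrow> nat set \<Rightarrow> (int \<Rightarrow> int) set" where
  "quotientD n I =
     {\<sigma> \<in> even_signed_perms n. \<forall>i \<in> I. entryD \<sigma> i < entryD \<sigma> (i + 1)}"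

definition quotientD_poly :: "nat \<Rightarrow> nat set \<Rightarrow> int poly" where
  "quotientD_poly n I =
     (\<Sum>\<sigma> \<in> quotientD n I. monom ((- 1) ^ lengthD n \<sigma>) (odd_lengthD n \<sigma>))"

definition interval_in :: "nat set \<Rightarrow> nat set \<Rightarrow> bool" where
  "interval_in I J \<longleftrightarrow> J \<subseteq> I \<and> (\<exists>a b. a \<le> b \<and> J = {a..b})"

definition components :: "nat set \<Rightarrow> nat set set" where
  "components I =
     {J. interval_in I J \<and> (\<forall>J'. interval_in I J' \<and> J \<subseteq> J' \<longrightarrow> J' = J)}"

text \<open>
  The sum \<open>m\<^sub>I\<close> ranges over \<open>I\<^sub>0, I\<^sub>1, \<dots>, I\<^sub>s\<close>, where \<open>I\<^sub>0\<close> is the component containing \<open>0\<close>,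
  or empty if \<open>0 \<notin> I\<close>. Components are nonempty here: an empty \<open>I\<^sub>0\<close> would contribute
  \<open>(0 + 1) div 2 = 0\<close>.
\<close>

definition component_sum :: "nat set \<Rightarrow> nat" where
  "component_sum I = (\<Sum>J \<in> components I. (card J + 1) div 2)"

end

theory Submission
  imports Defs
begin

text \<open>
  Every pair of positions \<open>i < j\<close> contributes a factor \<open>-1\<close> (equal parity) or \<open>-x\<close> (different parity)
  for each of the events \<open>\<sigma> i > \<sigma> j\<close> and \<open>\<sigma> i + \<sigma> j < 0\<close>. So the sum depends only on the sequence of
  parities (colours) of the positions and on its division into increasing blocks; cutting off the
  entry of largest absolute value gives a recursion on such coloured shapes. By this recursion a
  linear relation between two neighbouring blocks holds in every context as soon as it survives
  the removal of a largest entry from these blocks. In this way an alternating block followed by a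
  single position is a combination of one or two longer alternating blocks, and two neighbouring
  single positions of the same colour give \<open>0\<close>. Solving these relations, a block of length \<open>b\<close>
  equals, up to the denominator \<open>\<Prod>k \<le> b div 2. 1 - x ^ (2 * k)\<close>, a sequence of single positions
  (plus a term that vanishes next to a block of odd length). Adding single positions one by one to
  the leading block, which carries the condition at \<open>0\<close>, produces the factors of the product. As
  denominators depend only on the numbers \<open>b div 2\<close>, they cancel when a shape is compared with the
  one that has the same even parts but only one or two single positions; the generating function
  of the latter is the cofactor.
\<close>

section \<open>Coloured shapes and removal of the largest entry\<close>

definition X :: "int poly" where "X = monom 1 1"

definition wt :: "bool \<Rightarrow> bool \<Rightarrow> int poly" where
  "wt c d = (if c = d then - 1 else - X)"

definition Wt :: "bool \<Rightarrow> bool list \<Rightarrow> int poly" where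
  "Wt c ds = (\<Prod>d\<leftarrow>ds. wt c d)"

definition pair_wt :: "int \<times> bool \<Rightarrow> int \<times> bool \<Rightarrow> int poly" where
  "pair_wt a b =
     (if fst b < fst a then wt (snd a) (snd b) else 1) *
     (if fst a + fst b < 0 then wt (snd a) (snd b) else 1)"

fun word_wt :: "(int \<times> bool) list \<Rightarrow> int poly" where
  "word_wt [] = 1"
| "word_wt (a # u) = (\<Prod>b\<leftarrow>u. pair_wt a b) * word_wt u"

text \<open>
  A shape lists the blocks of consecutive positions on which the entries increase. Positions are
  recorded by their parity only. The flag marks blocks whose entries are required to be positive:
  it encodes \<open>0 \<in> I\<close>, because changing the sign of the first entry exchanges the two
  kinds of inversions.
\<close>
type_synonym shape = "(bool \<times> bool list) list"

definition cols :: "shape \<Rightarrow> bool list" where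
  "cols Bs = concat (map snd Bs)"

definition fills :: "bool \<times> bool list \<Rightarrow> (int \<times> bool) list \<Rightarrow> bool" where
  "fills B w \<longleftrightarrow> map snd w = snd B \<and> sorted_wrt (<) (map fst w) \<and>
     (fst B \<longrightarrow> (\<forall>a\<in>set w. 0 < fst a))"

definition abs_vals :: "(int \<times> bool) list \<Rightarrow> int multiset" where
  "abs_vals u = mset (map (\<lambda>a. \<bar>fst a\<bar>) u)"

text \<open>Absolute values run through \<open>1\<close>, ..., \<open>N\<close> without repetition,
  so the concatenated entries are the values of a signed permutation at \<open>1\<close>, ...,
  \<open>N\<close>. The list of lists keeps the block boundaries.\<close>

definition fillings :: "shape \<Rightarrow> (int \<times> bool) list list set" where
  "fillings Bs = {ws. list_all2 fills Bs ws \<and>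
     abs_vals (concat ws) = mset [1..int (length (cols Bs))]}"

definition gf :: "shape \<Rightarrow> int poly" where
  "gf Bs = (\<Sum>ws\<in>fillings Bs. word_wt (concat ws))"

text \<open>The part of \<open>gf\<close> in which the entry of largest absolute value
  \<open>N\<close> lies in the block \<open>B\<close>. As blocks increase, it is \<open>N\<close> in
  last place or \<open>- N\<close> in first place. \<open>N\<close> takes part in one event with
  each later position and in none with earlier ones; \<open>- N\<close> takes part in one event with
  each later position and in both events with each earlier one, hence the square.\<close>

definition peel_block :: "shape \<Rightarrow> bool \<times> bool list \<Rightarrow> shape \<Rightarrow> int poly" where
  "peel_block P B Q = (case B of (p, Y) \<Rightarrow> if Y = [] then 0 else
     Wt (last Y) (cols Q) * gf (P @ (p, butlast Y) # Q) +
     (if p then 0 else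
       Wt (hd Y) (tl Y @ cols Q) * Wt (hd Y) (cols P) ^ 2 * gf (P @ (p, tl Y) # Q)))"

fun peel :: "shape \<Rightarrow> shape \<Rightarrow> shape \<Rightarrow> int poly" where
  "peel P [] Q = 0"
| "peel P (B # M) Q = peel_block P B (M @ Q) + peel (P @ [B]) M Q"

lemma Wt_Nil [simp]: "Wt c [] = 1"
  and Wt_Cons [simp]: "Wt c (d # ds) = wt c d * Wt c ds"
  and Wt_append [simp]: "Wt c (ds @ es) = Wt c ds * Wt c es"
  by (simp_all add: Wt_def)

lemma Wt_cong_mset: "mset ds = mset es \<Longrightarrow> Wt c ds = Wt c es"
  unfolding Wt_def by (metis mset_map prod_mset_prod_list)

lemma cols_simps [simp]: "cols [] = []" "cols (B # Bs) = snd B @ cols Bs"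
  "cols (P @ Q) = cols P @ cols Q"
  by (simp_all add: cols_def)

lemma abs_vals_simps [simp]: "abs_vals [] = {#}"
  "abs_vals (a # u) = add_mset \<bar>fst a\<bar> (abs_vals u)"
  "abs_vals (u @ v) = abs_vals u + abs_vals v"
  by (simp_all add: abs_vals_def)

lemma word_wt_insert:
  "word_wt (u @ a # v) =
     (\<Prod>b\<leftarrow>u. pair_wt b a) * (\<Prod>b\<leftarrow>v. pair_wt a b) * word_wt (u @ v)"
  by (induction u) (simp_all add: algebra_simps)

lemma pair_wt_max:
  assumes "\<bar>fst b\<bar> < N"
  shows "pair_wt b (N, c) = 1" "pair_wt (N, c) b = wt c (snd b)"
    "pair_wt b (- N, c) = wt c (snd b) ^ 2" "pair_wt (- N, c) b = wt c (snd b)"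
  using assms by (auto simp: pair_wt_def wt_def power2_eq_square)

lemma prod_list_eq_Wt:
  assumes "\<And>b. b \<in> set u \<Longrightarrow> f b = wt c (snd b)"
  shows "(\<Prod>b\<leftarrow>u. f b) = Wt c (map snd u)"
  using assms by (induction u) auto

lemma prod_list_eq_Wt_square:
  assumes "\<And>b. b \<in> set u \<Longrightarrow> f b = wt c (snd b) ^ 2"
  shows "(\<Prod>b\<leftarrow>u. f b) = Wt c (map snd u) ^ 2"
  using assms by (induction u) (auto simp: power_mult_distrib)

lemma word_wt_insert_max:
  assumes "\<And>b. b \<in> set (u @ v) \<Longrightarrow> \<bar>fst b\<bar> < N"
  shows "word_wt (u @ (N, c) # v) = Wt c (map snd v) * word_wt (u @ v)"
    and "word_wt (u @ (- N, c) # v) =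
      Wt c (map snd v) * Wt c (map snd u) ^ 2 * word_wt (u @ v)"
proof -
  have "(\<Prod>b\<leftarrow>u. pair_wt b (N, c)) = (\<Prod>b\<leftarrow>u. 1)"
    using assms by (intro arg_cong[of _ _ prod_list] map_cong) (auto simp: pair_wt_max)
  also have "\<dots> = 1"
    by (induction u) auto
  finally have "(\<Prod>b\<leftarrow>u. pair_wt b (N, c)) = 1" .
  moreover have "(\<Prod>b\<leftarrow>v. pair_wt (N, c) b) = Wt c (map snd v)"
    using assms by (intro prod_list_eq_Wt) (auto simp: pair_wt_max)
  ultimately show "word_wt (u @ (N, c) # v) = Wt c (map snd v) * word_wt (u @ v)"
    by (simp add: word_wt_insert)
  have "(\<Prod>b\<leftarrow>u. pair_wt b (- N, c)) = Wt c (map snd u) ^ 2"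
    using assms by (intro prod_list_eq_Wt_square) (auto simp: pair_wt_max)
  moreover have "(\<Prod>b\<leftarrow>v. pair_wt (- N, c) b) = Wt c (map snd v)"
    using assms by (intro prod_list_eq_Wt) (auto simp: pair_wt_max)
  ultimately show "word_wt (u @ (- N, c) # v) =
      Wt c (map snd v) * Wt c (map snd u) ^ 2 * word_wt (u @ v)"
    by (simp add: word_wt_insert)
qed

lemma map_snd_concat_fills:
  "list_all2 fills Bs ws \<Longrightarrow> map snd (concat ws) = cols Bs"
  by (induction rule: list_all2_induct) (auto simp: fills_def)

lemma set_abs_vals: "set_mset (abs_vals u) = (\<lambda>a. \<bar>fst a\<bar>) ` set u"
  by (simp add: abs_vals_def)

lemma filling_bound:
  assumes "ws \<in> fillings Bs" "a \<in> set (concat ws)"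
  shows "1 \<le> \<bar>fst a\<bar>" "\<bar>fst a\<bar> \<le> int (length (cols Bs))"
proof -
  have "\<bar>fst a\<bar> \<in> set_mset (mset [1..int (length (cols Bs))])"
    using assms set_abs_vals[of "concat ws"] by (auto simp: fillings_def)
  then show "1 \<le> \<bar>fst a\<bar>" "\<bar>fst a\<bar> \<le> int (length (cols Bs))" by auto
qed

lemma finite_fillings: "finite (fillings Bs)"
proof (rule finite_subset)
  let ?n = "length (cols Bs)"
  let ?V = "{- int ?n..int ?n} \<times> (UNIV :: bool set)"
  let ?W = "{w. set w \<subseteq> ?V \<and> length w \<le> ?n}"
  show "finite {ws. set ws \<subseteq> ?W \<and> length ws = length Bs}"
    by (intro finite_lists_length_eq finite_lists_length_le) auto
  show "fillings Bs \<subseteq> {ws. set ws \<subseteq> ?W \<and> length ws = length Bs}"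
  proof
    fix ws assume ws: "ws \<in> fillings Bs"
    then have l: "list_all2 fills Bs ws" by (simp add: fillings_def)
    have "set w \<subseteq> ?V" if "w \<in> set ws" for w
      using filling_bound[OF ws] that by (fastforce simp: abs_le_iff)
    moreover have "length w \<le> ?n" if "w \<in> set ws" for w
    proof -
      have "length (concat ws) = ?n"
        using map_snd_concat_fills[OF l] by (metis length_map)
      moreover have "length w \<le> length (concat ws)"
        using that by (auto dest!: split_list)
      ultimately show ?thesis by simp
    qed
    ultimately show "ws \<in> {ws. set ws \<subseteq> ?W \<and> length ws = length Bs}"
      using list_all2_lengthD[OF l] by auto
  qed
qed

lemma gf_eq_1:
  assumes "cols Bs = []" shows "gf Bs = 1"
proof -
  have "list_all2 fills Bs ws \<longleftrightarrow> ws = map (\<lambda>_. []) Bs" if "\<forall>B\<in>set Bs. snd B = []" for ws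
    using that
  proof (induction Bs arbitrary: ws)
    case (Cons B Bs)
    then show ?case by (cases ws) (auto simp: fills_def)
  qed simp
  moreover have "\<forall>B\<in>set Bs. snd B = []" using assms by (auto simp: cols_def)
  moreover have empty: "concat (map (\<lambda>_. []) Bs) = ([] :: (int \<times> bool) list)" by simp
  ultimately have "fillings Bs = {map (\<lambda>_. []) Bs}"
    unfolding fillings_def using assms by (auto simp: empty)
  then show ?thesis by (simp add: gf_def empty)
qed

lemma bij_betw_fillings_insert:
  fixes P Q :: shape and p :: bool and Y1 Y2 :: "bool list" and c :: bool and s :: int
  defines "N \<equiv> int (length (cols (P @ (p, Y1 @ c # Y2) # Q)))"
  assumes s: "s = 1 \<and> Y2 = [] \<or> s = - 1 \<and> Y1 = [] \<and> \<not> p"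
  defines "k \<equiv> length P" and "j \<equiv> length Y1"
  shows "bij_betw (\<lambda>ws. ws[k := take j (ws ! k) @ (s * N, c) # drop j (ws ! k)])
           (fillings (P @ (p, Y1 @ Y2) # Q))
           {ws \<in> fillings (P @ (p, Y1 @ c # Y2) # Q). fst (ws ! k ! j) = s * N}"
    (is "bij_betw ?f ?A ?B")
proof (rule bij_betw_byWitness[where f' = "\<lambda>ws. ws[k := take j (ws ! k) @ drop (Suc j) (ws ! k)]"])
  let ?g = "\<lambda>ws. ws[k := take j (ws ! k) @ drop (Suc j) (ws ! k)]"
  have upto: "mset [1..N] = add_mset N (mset [1..N - 1])"
    unfolding N_def by (subst upto_rec2) auto
  have s2: "\<bar>s * N\<bar> = N" using s by (auto simp: N_def)
  {
    fix ws assume ws: "ws \<in> ?A"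
    then obtain V w U where V: "ws = V @ w # U" "list_all2 fills P V" "fills (p, Y1 @ Y2) w"
        "list_all2 fills Q U"
      unfolding fillings_def
      by (auto simp: list_all2_append1 list_all2_Cons1)
    have k: "length V = k" using V(2) by (simp add: k_def list_all2_lengthD)
    define w1 w2 where "w1 = take j w" and "w2 = drop j w"
    have w: "w = w1 @ w2" by (simp add: w1_def w2_def)
    have "map snd w = Y1 @ Y2" using V(3) by (simp add: fills_def)
    then have sw: "map snd w1 = Y1" "map snd w2 = Y2"
      by (simp_all add: w1_def w2_def j_def take_map drop_map flip: take_map drop_map)
    then have lw: "length w1 = j" by (auto simp: j_def)
    have f: "?f ws = V @ (w1 @ (s * N, c) # w2) # U"
      using V(1) k w lw by (auto simp: list_update_append)
    have bound: "\<bar>fst a\<bar> < N" if "a \<in> set w" for a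
      using filling_bound(2)[OF ws, of a] that V(1) by (auto simp: N_def)
    have "fills (p, Y1 @ c # Y2) (w1 @ (s * N, c) # w2)"
    proof -
      have srt: "sorted_wrt (<) (map fst (w1 @ w2))" using V(3) w by (simp add: fills_def)
      have bnd: "- N < fst a \<and> fst a < N" if "a \<in> set (w1 @ w2)" for a
      proof -
        have "\<bar>fst a\<bar> < N" using bound that w by blast
        then show ?thesis by linarith
      qed
      have pos: "\<forall>a\<in>set (w1 @ w2). 0 < fst a" if p using V(3) w that by (simp add: fills_def)
      have "N > 0" by (simp add: N_def)
      from s consider (hi) "s = 1" "w2 = []" | (lo) "s = - 1" "w1 = []" "\<not> p"
        using sw by blast
      then show ?thesis
      proof cases
        case hi
        then show ?thesis
          using srt bnd pos sw \<open>N > 0\<close> by (simp add: fills_def sorted_wrt_append)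
      next
        case lo
        then show ?thesis
          using srt bnd sw by (simp add: fills_def)
      qed
    qed
    moreover have "abs_vals (concat (?f ws)) = mset [1..N]"
    proof -
      have "abs_vals (concat ws) = mset [1..N - 1]" using ws by (simp add: fillings_def N_def)
      then have "abs_vals (concat (V @ (w1 @ w2) # U)) = mset [1..N - 1]" using V(1) w by simp
      then show ?thesis unfolding f upto by (simp add: s2)
    qed
    ultimately have "?f ws \<in> ?B"
      using V f k lw by (auto simp: fillings_def N_def list_all2_append list_all2_lengthD nth_append)
    moreover have "?g (?f ws) = ws"
      unfolding f using V(1) k lw w by (auto simp: list_update_append)
    ultimately have "?f ws \<in> ?B \<and> ?g (?f ws) = ws" ..
  } note * = this
  {
    fix ws assume ws: "ws \<in> ?B"
    then obtain V w U where V: "ws = V @ w # U" "list_all2 fills P V" "fills (p, Y1 @ c # Y2) w"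
        "list_all2 fills Q U"
      unfolding fillings_def
      by (auto simp: list_all2_append1 list_all2_Cons1)
    have k: "length V = k" using V(2) by (simp add: k_def list_all2_lengthD)
    define w1 w2 where "w1 = take j w" and "w2 = drop (Suc j) w"
    have mw: "map snd w = Y1 @ c # Y2" using V(3) by (simp add: fills_def)
    from arg_cong[OF mw, of length] have "j < length w" by (simp add: j_def)
    then have w: "w = w1 @ (w ! j) # w2" by (simp add: w1_def w2_def id_take_nth_drop)
    have lw: "length w1 = j" using \<open>j < length w\<close> by (simp add: w1_def)
    have sw: "map snd w1 = Y1" "snd (w ! j) = c" "map snd w2 = Y2"
    proof -
      show "map snd w1 = Y1" unfolding w1_def take_map[symmetric] mw by (simp add: j_def)
      show "map snd w2 = Y2" unfolding w2_def drop_map[symmetric] mw by (simp add: j_def)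
      show "snd (w ! j) = c"
        unfolding nth_map[OF \<open>j < length w\<close>, symmetric] mw by (simp add: j_def)
    qed
    have "fst (w ! j) = s * N" using ws V(1) k by (auto simp: nth_append)
    then have "w ! j = (s * N, c)" using sw(2) by (simp add: prod_eq_iff)
    with w have w': "w = w1 @ (s * N, c) # w2" by simp
    have g: "?g ws = V @ (w1 @ w2) # U"
      using V(1) k w' lw by (auto simp: list_update_append)
    have "fills (p, Y1 @ Y2) (w1 @ w2)"
      using V(3) sw w' by (auto simp: fills_def sorted_wrt_append)
    moreover have "abs_vals (concat (?g ws)) = mset [1..N - 1]"
    proof -
      have "abs_vals (concat ws) = add_mset N (mset [1..N - 1])"
        using ws unfolding upto[symmetric] by (simp add: fillings_def N_def)
      moreover have "abs_vals (concat ws) = add_mset N (abs_vals (concat (V @ (w1 @ w2) # U)))"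
        unfolding V(1) w' by (simp add: s2)
      ultimately show ?thesis unfolding g by simp
    qed
    ultimately have "?g ws \<in> ?A"
      unfolding g using V by (auto simp: fillings_def N_def list_all2_append list_all2_lengthD)
    moreover have "?f (?g ws) = ws"
      unfolding g using V(1) k lw w' by (auto simp: list_update_append)
    ultimately have "?g ws \<in> ?A \<and> ?f (?g ws) = ws" ..
  } note ** = this
  show "\<forall>a\<in>?A. ?g (?f a) = a" "\<forall>a\<in>?B. ?f (?g a) = a" "?f ` ?A \<subseteq> ?B" "?g ` ?B \<subseteq> ?A"
    using * ** by (intro ballI image_subsetI; fast)+
qed

lemma sum_fillings_insert:
  fixes P Q :: shape and p :: bool and Y1 Y2 :: "bool list" and c :: bool and s :: int
  defines "N \<equiv> int (length (cols (P @ (p, Y1 @ c # Y2) # Q)))"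
  assumes s: "s = 1 \<and> Y2 = [] \<or> s = - 1 \<and> Y1 = [] \<and> \<not> p"
  shows "(\<Sum>ws | ws \<in> fillings (P @ (p, Y1 @ c # Y2) # Q) \<and>
             fst (ws ! length P ! length Y1) = s * N. word_wt (concat ws)) =
    Wt c (Y2 @ cols Q) * (if s = 1 then 1 else Wt c (cols P) ^ 2) * gf (P @ (p, Y1 @ Y2) # Q)"
proof -
  let ?k = "length P" and ?j = "length Y1"
  have "(\<Sum>ws | ws \<in> fillings (P @ (p, Y1 @ c # Y2) # Q) \<and>
             fst (ws ! ?k ! ?j) = s * N. word_wt (concat ws)) =
      (\<Sum>ws\<in>fillings (P @ (p, Y1 @ Y2) # Q). word_wt (concat
         (ws[?k := take ?j (ws ! ?k) @ (s * N, c) # drop ?j (ws ! ?k)])))"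
    using sum.reindex_bij_betw[OF bij_betw_fillings_insert[OF s, of P c Q],
        of "\<lambda>ws. word_wt (concat ws)"] by (simp add: N_def)
  also have "\<dots> = (\<Sum>ws\<in>fillings (P @ (p, Y1 @ Y2) # Q).
      Wt c (Y2 @ cols Q) * (if s = 1 then 1 else Wt c (cols P) ^ 2) * word_wt (concat ws))"
  proof (rule sum.cong[OF refl])
    fix ws assume ws: "ws \<in> fillings (P @ (p, Y1 @ Y2) # Q)"
    then obtain V w U where V: "ws = V @ w # U" "list_all2 fills P V" "fills (p, Y1 @ Y2) w"
        "list_all2 fills Q U"
      unfolding fillings_def
      by (auto simp: list_all2_append1 list_all2_Cons1)
    have k: "length V = ?k" using V(2) by (simp add: list_all2_lengthD)
    define w1 w2 where "w1 = take ?j w" and "w2 = drop ?j w"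
    have w: "w = w1 @ w2" by (simp add: w1_def w2_def)
    have "map snd w = Y1 @ Y2" using V(3) by (simp add: fills_def)
    then have sw: "map snd w1 = Y1" "map snd w2 = Y2"
      by (simp_all add: w1_def w2_def flip: take_map drop_map)
    then have lw: "length w1 = ?j" by auto
    have "ws ! ?k = w" using V(1) k by (metis nth_append_length)
    then have eq: "concat (ws[?k := take ?j (ws ! ?k) @ (s * N, c) # drop ?j (ws ! ?k)]) =
        (concat V @ w1) @ (s * N, c) # (w2 @ concat U)"
      using V(1) k w lw by (simp add: list_update_append)
    have eq': "concat ws = (concat V @ w1) @ (w2 @ concat U)" using V(1) w by simp
    have b: "\<bar>fst a\<bar> < N" if "a \<in> set ((concat V @ w1) @ (w2 @ concat U))" for a
      using filling_bound(2)[OF ws, of a] that unfolding eq' by (auto simp: N_def)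
    have cols2: "map snd (w2 @ concat U) = Y2 @ cols Q"
      using sw map_snd_concat_fills[OF V(4)] by simp
    have cols1: "map snd (concat V @ w1) = cols P @ Y1"
      using sw map_snd_concat_fills[OF V(2)] by simp
    have hi: "word_wt ((concat V @ w1) @ (N, c) # (w2 @ concat U)) =
        Wt c (Y2 @ cols Q) * word_wt ((concat V @ w1) @ (w2 @ concat U))"
      unfolding cols2[symmetric] by (rule word_wt_insert_max(1)) (rule b)
    have lo: "word_wt ((concat V @ w1) @ (- N, c) # (w2 @ concat U)) =
        Wt c (Y2 @ cols Q) * Wt c (cols P @ Y1) ^ 2 * word_wt ((concat V @ w1) @ (w2 @ concat U))"
      unfolding cols2[symmetric] cols1[symmetric] by (rule word_wt_insert_max(2)) (rule b)
    from s consider (hi) "s = 1" "Y2 = []" | (lo) "s = - 1" "Y1 = []" by blast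
    then show "word_wt (concat (ws[?k := take ?j (ws ! ?k) @ (s * N, c) # drop ?j (ws ! ?k)])) =
        Wt c (Y2 @ cols Q) * (if s = 1 then 1 else Wt c (cols P) ^ 2) * word_wt (concat ws)"
    proof cases
      case hi
      show ?thesis unfolding eq eq' unfolding hi(1) mult_1 \<open>word_wt ((concat V @ w1) @ (N, c) # _) = _\<close>
        by simp
    next
      case lo
      show ?thesis unfolding eq eq' unfolding lo(1) mult_minus1 \<open>word_wt ((concat V @ w1) @ (- N, c) # _) = _\<close>
        by (simp add: lo(2))
    qed
  qed
  finally show ?thesis by (simp add: gf_def sum_distrib_left)
qed

section \<open>Decomposition by the place of the largest absolute value\<close>

lemma distinct_concat_nth:
  "distinct (concat xss) \<Longrightarrow> i < j \<Longrightarrow> j < length xss \<Longrightarrow> set (xss ! i) \<inter> set (xss ! j) = {}"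
proof (induction xss arbitrary: i j)
  case (Cons xs xss)
  then show ?case by (cases i; cases j) (fastforce simp: disjoint_iff)+
qed simp

text \<open>Some entry has absolute value \<open>N\<close>, and only one does. By monotonicity it is
  the last or the first entry of its block, so the sets \<open>Hi k\<close> and \<open>Lo k\<close>
  partition the fillings.\<close>

lemma gf_split_max:
  assumes "cols Bs \<noteq> []"
  shows "gf Bs = (\<Sum>k<length Bs. peel_block (take k Bs) (Bs ! k) (drop (Suc k) Bs))"
proof -
  define N where "N = int (length (cols Bs))"
  define Hi Lo where
    "Hi k = {ws \<in> fillings Bs. ws ! k \<noteq> [] \<and> fst (last (ws ! k)) = N}" and
    "Lo k = {ws \<in> fillings Bs. ws ! k \<noteq> [] \<and> fst (hd (ws ! k)) = - N}" for k
  have N: "N > 0" using assms by (simp add: N_def)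
  have fills: "fills (Bs ! k) (ws ! k)" if "ws \<in> fillings Bs" "k < length Bs" for ws k
    using that by (auto simp: fillings_def list_all2_conv_all_nth)
  have len: "length ws = length Bs" if "ws \<in> fillings Bs" for ws
    using that by (auto simp: fillings_def list_all2_lengthD)
  have bound: "\<bar>fst a\<bar> \<le> N" if "ws \<in> fillings Bs" "k < length Bs" "a \<in> set (ws ! k)" for ws k a
  proof -
    have "ws ! k \<in> set ws" using that len by simp
    then show ?thesis using filling_bound(2)[OF that(1), of a] that(3) by (auto simp: N_def)
  qed
  have cover: "fillings Bs = (\<Union>k<length Bs. Hi k \<union> Lo k)"
  proof (intro equalityI subsetI)
    fix ws assume ws: "ws \<in> fillings Bs"
    have "abs_vals (concat ws) = mset [1..N]" using ws by (simp add: fillings_def N_def)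
    moreover have "N \<in># mset [1..N]" using N by simp
    ultimately have "N \<in># abs_vals (concat ws)" by (simp only:)
    then have "N \<in> (\<lambda>a. \<bar>fst a\<bar>) ` set (concat ws)" by (simp only: set_abs_vals)
    then obtain a where "N = \<bar>fst a\<bar>" "a \<in> set (concat ws)" by (rule imageE)
    then have a: "a \<in> set (concat ws)" "\<bar>fst a\<bar> = N" by simp_all
    from a(1) obtain w where w: "w \<in> set ws" "a \<in> set w" by auto
    from w(1) obtain k where "k < length ws" "ws ! k = w" unfolding in_set_conv_nth by blast
    then have k: "k < length Bs" "a \<in> set (ws ! k)" using w(2) len[OF ws] by simp_all
    have ne: "ws ! k \<noteq> []" using k by auto
    have srt: "sorted_wrt (<) (map fst (ws ! k))" using fills[OF ws k(1)] by (simp add: fills_def)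
    have "ws \<in> Hi k \<union> Lo k"
    proof (cases "fst a \<ge> 0")
      case True
      have "fst a \<le> fst (last (ws ! k))"
        using srt k(2) ne by (cases "ws ! k" rule: rev_cases) (auto simp: sorted_wrt_append)
      moreover have "\<bar>fst (last (ws ! k))\<bar> \<le> N" using bound[OF ws k(1)] ne by simp
      ultimately show ?thesis using ws ne a True by (simp add: Hi_def)
    next
      case False
      have "fst (hd (ws ! k)) \<le> fst a"
        using srt k(2) ne by (cases "ws ! k") auto
      moreover have "\<bar>fst (hd (ws ! k))\<bar> \<le> N" using bound[OF ws k(1)] ne by simp
      ultimately show ?thesis using ws ne a False by (simp add: Lo_def)
    qed
    then show "ws \<in> (\<Union>k<length Bs. Hi k \<union> Lo k)" using k(1) by blast
  qed (auto simp: Hi_def Lo_def)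
  \<comment> \<open>Distinctness of the absolute values separates different blocks, and within one
    block it separates \<open>Hi\<close> from \<open>Lo\<close>.\<close>
  have uniq: "k = l \<and> a = b"
    if "ws \<in> fillings Bs" "k < length Bs" "l < length Bs" "a \<in> set (ws ! k)" "b \<in> set (ws ! l)"
      "\<bar>fst a\<bar> = N" "\<bar>fst b\<bar> = N" for ws k l a b
  proof -
    let ?A = "map (map (\<lambda>a. \<bar>fst a\<bar>)) ws"
    have "mset (concat ?A) = mset [1..N]"
      using that(1) by (simp add: fillings_def abs_vals_def map_concat N_def)
    then have d: "distinct (concat ?A)"
      by (metis distinct_upto mset_eq_imp_distinct_iff)
    have "k = l"
    proof (rule ccontr)
      assume "k \<noteq> l"
      then have "set (?A ! k) \<inter> set (?A ! l) = {}"
        using distinct_concat_nth[OF d, of k l] distinct_concat_nth[OF d, of l k]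
          that(2,3) len[OF that(1)] \<open>k \<noteq> l\<close>
        by (cases k l rule: linorder_cases) (auto simp: Int_commute)
      moreover have "N \<in> set (?A ! k)" "N \<in> set (?A ! l)"
        using that(2-7) len[OF that(1)] by (auto intro: rev_image_eqI)
      ultimately show False by blast
    qed
    moreover have "inj_on (\<lambda>a. \<bar>fst a\<bar>) (set (ws ! k))"
    proof -
      have "?A ! k \<in> set ?A" using that len[OF that(1)] by (metis length_map nth_mem)
      then have "distinct (?A ! k)" using d by (auto simp: distinct_concat_iff)
      then show ?thesis using that(2) len[OF that(1)] by (simp add: distinct_map)
    qed
    ultimately show ?thesis using that(4-7) by (auto dest: inj_onD)
  qed
  have memH: "\<exists>a\<in>set (ws ! k). fst a = N" if "ws \<in> Hi k" for ws k
    using that by (auto simp: Hi_def intro!: bexI[of _ "last (ws ! k)"])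
  have memL: "\<exists>a\<in>set (ws ! k). fst a = - N" if "ws \<in> Lo k" for ws k
    using that by (auto simp: Lo_def intro!: bexI[of _ "hd (ws ! k)"])
  have mem: "\<exists>a\<in>set (ws ! k). \<bar>fst a\<bar> = N" if "ws \<in> Hi k \<union> Lo k" for ws k
    using that
  proof
    assume "ws \<in> Hi k"
    then show ?thesis using memH[of ws k] N by (metis abs_of_pos)
  next
    assume "ws \<in> Lo k"
    then show ?thesis using memL[of ws k] N by (metis abs_minus_cancel abs_of_pos)
  qed
  have in_f: "ws \<in> fillings Bs" if "ws \<in> Hi k \<union> Lo k" for ws k
    using that by (auto simp: Hi_def Lo_def)
  have disj: "(Hi k \<union> Lo k) \<inter> (Hi l \<union> Lo l) = {}" if "k < length Bs" "l < length Bs" "k \<noteq> l" for k l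
  proof (rule ccontr)
    assume "(Hi k \<union> Lo k) \<inter> (Hi l \<union> Lo l) \<noteq> {}"
    then obtain ws where ws: "ws \<in> Hi k \<union> Lo k" "ws \<in> Hi l \<union> Lo l" by blast
    show False using mem[OF ws(1)] mem[OF ws(2)] uniq[OF in_f[OF ws(1)] that(1,2)] that(3) by blast
  qed
  have disj': "Hi k \<inter> Lo k = {}" if "k < length Bs" for k
  proof -
    have False if ws: "ws \<in> Hi k" "ws \<in> Lo k" for ws
    proof -
      from memH[OF ws(1)] memL[OF ws(2)] obtain a b
        where "a \<in> set (ws ! k)" "fst a = N" "b \<in> set (ws ! k)" "fst b = - N"
        by blast
      then show False using uniq[of ws k k a b] in_f[of ws k] ws(1) \<open>k < length Bs\<close> N by auto
    qed
    then show ?thesis by blast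
  qed
  have fin: "finite (Hi k)" "finite (Lo k)" for k
    using finite_fillings by (auto simp: Hi_def Lo_def)
  have "gf Bs = (\<Sum>k<length Bs. \<Sum>ws\<in>Hi k \<union> Lo k. word_wt (concat ws))"
    unfolding gf_def cover
    using fin disj by (intro sum.UNION_disjoint) auto
  also have "\<dots> = (\<Sum>k<length Bs. peel_block (take k Bs) (Bs ! k) (drop (Suc k) Bs))"
  proof (rule sum.cong[OF refl])
    fix k assume "k \<in> {..<length Bs}"
    then have k: "k < length Bs" by simp
    obtain p Y where pY: "Bs ! k = (p, Y)" by fastforce
    define P Q where "P = take k Bs" and "Q = drop (Suc k) Bs"
    have Bs: "Bs = P @ (p, Y) # Q" unfolding P_def Q_def pY[symmetric] using k by (rule id_take_nth_drop)
    have lP: "length P = k" using k by (simp add: P_def)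
    have lw: "length (ws ! k) = length Y" if "ws \<in> fillings Bs" for ws
      using fills[OF that k] by (metis fills_def length_map pY snd_conv)
    have "(\<Sum>ws\<in>Hi k \<union> Lo k. word_wt (concat ws)) = peel_block P (p, Y) Q"
    proof (cases "Y = []")
      case True
      then have "Hi k = {}" "Lo k = {}" using lw by (auto simp: Hi_def Lo_def)
      then show ?thesis using True by (simp add: peel_block_def)
    next
      case False
      have H: "(\<Sum>ws\<in>Hi k. word_wt (concat ws)) =
          Wt (last Y) (cols Q) * gf (P @ (p, butlast Y) # Q)"
      proof -
        have last: "ws ! k \<noteq> [] \<and> last (ws ! k) = ws ! length P ! length (butlast Y)"
          if "ws \<in> fillings Bs" for ws
        proof -
          have "ws ! k \<noteq> []" using lw[OF that] False by (metis length_0_conv)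
          then show ?thesis using lw[OF that] by (simp add: last_conv_nth lP)
        qed
        have Hi: "Hi k = {ws. ws \<in> fillings Bs \<and> fst (ws ! length P ! length (butlast Y)) = 1 * N}"
          unfolding Hi_def using last by (intro Collect_cong) (metis mult_1)
        have Bs': "Bs = P @ (p, butlast Y @ last Y # []) # Q" using Bs False by simp
        show ?thesis
          using sum_fillings_insert[of 1 "[]" "butlast Y" p P "last Y" Q, folded Bs', folded N_def]
          unfolding Hi by simp
      qed
      have L: "(\<Sum>ws\<in>Lo k. word_wt (concat ws)) = (if p then 0 else
          Wt (hd Y) (tl Y @ cols Q) * Wt (hd Y) (cols P) ^ 2 * gf (P @ (p, tl Y) # Q))"
      proof (cases p)
        case True
        have "Lo k = {}"
        proof (rule ccontr)
          assume "Lo k \<noteq> {}"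
          then obtain ws a where "ws \<in> fillings Bs" "a \<in> set (ws ! k)" "fst a = - N"
            using memL in_f by blast
          then show False using fills[of ws k] k N True pY by (auto simp: fills_def)
        qed
        then show ?thesis using True by simp
      next
        case F: False
        have hd: "ws ! k \<noteq> [] \<and> hd (ws ! k) = ws ! length P ! length ([] :: bool list)"
          if "ws \<in> fillings Bs" for ws
        proof -
          have "ws ! k \<noteq> []" using lw[OF that] False by (metis length_0_conv)
          then show ?thesis by (simp add: hd_conv_nth lP)
        qed
        have Lo: "Lo k = {ws. ws \<in> fillings Bs \<and>
            fst (ws ! length P ! length ([] :: bool list)) = - 1 * N}"
          unfolding Lo_def using hd by (intro Collect_cong) (metis mult_minus1)
        have Bs': "Bs = P @ (p, [] @ hd Y # tl Y) # Q" using Bs False by simp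
        show ?thesis
          using sum_fillings_insert[of "- 1" "tl Y" "[]" p P "hd Y" Q, folded Bs', folded N_def] F
          unfolding Lo by simp
      qed
      show ?thesis
        using False H L fin disj'[OF k] by (subst sum.union_disjoint) (auto simp: peel_block_def)
    qed
    then show "(\<Sum>ws\<in>Hi k \<union> Lo k. word_wt (concat ws)) =
        peel_block (take k Bs) (Bs ! k) (drop (Suc k) Bs)"
      by (simp add: P_def Q_def pY)
  qed
  finally show ?thesis .
qed

lemma peel_eq_sum:
  "peel P M Q = (\<Sum>k<length M. peel_block (P @ take k M) (M ! k) (drop (Suc k) M @ Q))"
  by (induction P M Q rule: peel.induct) (simp_all add: sum.lessThan_Suc_shift del: sum.lessThan_Suc)

lemma gf_peel: "cols Bs \<noteq> [] \<Longrightarrow> gf Bs = peel [] Bs []"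
  by (simp add: gf_split_max peel_eq_sum)

section \<open>Local linear relations\<close>

abbreviation lin :: "(int poly \<times> shape) list \<Rightarrow> (shape \<Rightarrow> int poly) \<Rightarrow> int poly" where
  "lin L f \<equiv> (\<Sum>(k, M)\<leftarrow>L. k * f M)"

lemma lin_add: "lin L (\<lambda>M. f M + g M) = lin L f + lin L g"
  by (induction L) (auto simp: algebra_simps)

lemma lin_mult: "lin L (\<lambda>M. w * f M) = w * lin L f"
  by (induction L) (auto simp: algebra_simps)

lemma lin_cong: "(\<And>k M. (k, M) \<in> set L \<Longrightarrow> f M = g M) \<Longrightarrow> lin L f = lin L g"
  by (induction L) fastforce+

lemma lin_zero [simp]: "(\<Sum>(k, M)\<leftarrow>L. 0) = (0 :: int poly)"
  by (induction L) auto

lemma peel_append: "peel P (M @ M') Q = peel P M (M' @ Q) + peel (P @ M) M' Q"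
  by (induction P M "M' @ Q" rule: peel.induct) (simp_all add: algebra_simps)

text \<open>
  The set \<open>R\<close> of left contexts is closed under the removal of entries. It is needed only to treat
  relations that hold at the front of a shape but not elsewhere.
\<close>
lemma gf_relation:
  assumes closed: "\<And>P Y' B Q. P @ B # Q \<in> R \<Longrightarrow> P @ (fst B, Y') # Q \<in> R"
    and content: "\<And>k M. (k, M) \<in> set L \<Longrightarrow> mset (cols M) = \<mu>"
    and nonempty: "\<mu> \<noteq> {#} \<or> (\<Sum>(k, M)\<leftarrow>L. k) = 0"
    and local: "\<And>P Q. P \<in> R \<Longrightarrow> lin L (\<lambda>M. peel P M Q) = 0"
    and "P \<in> R"
  shows "lin L (\<lambda>M. gf (P @ M @ Q)) = 0"
  using \<open>P \<in> R\<close>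
proof (induction "length (cols P) + length (cols Q)" arbitrary: P Q rule: less_induct)
  case less
  obtain ds where ds: "\<mu> = mset ds" by (metis ex_mset)
  \<comment> \<open>A removal in the context sees \<open>M\<close> only through its multiset of
    colours. Hence all terms of \<open>L\<close> acquire the same weight, which factors out and
    leaves the relation in a smaller context.\<close>
  have Wt_content: "Wt c (cols M) = Wt c ds" if "(k, M) \<in> set L" for c k M
    using content[OF that] ds by (intro Wt_cong_mset) simp
  have left: "lin L (\<lambda>M. peel P1 P2 (M @ Q)) = 0" if "P1 @ P2 = P" for P1 P2
    using that
  proof (induction P2 arbitrary: P1)
    case (Cons B P2)
    obtain p Y where B: "B = (p, Y)" by fastforce
    have "lin L (\<lambda>M. peel_block P1 B (P2 @ M @ Q)) = 0"
    proof (cases "Y = []")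
      case True
      then show ?thesis by (simp add: peel_block_def B)
    next
      case False
      have IH: "lin L (\<lambda>M. gf (P1 @ (p, Y') # P2 @ M @ Q)) = 0" if "length Y' < length Y" for Y'
        using less(1)[of "P1 @ (p, Y') # P2" Q] closed[of P1 B P2 Y'] less(2) that Cons.prems B
        by auto
      have "lin L (\<lambda>M. peel_block P1 B (P2 @ M @ Q)) = lin L (\<lambda>M.
          Wt (last Y) (cols P2 @ ds @ cols Q) * gf (P1 @ (p, butlast Y) # P2 @ M @ Q) +
          (if p then 0 else Wt (hd Y) (tl Y @ cols P2 @ ds @ cols Q) * Wt (hd Y) (cols P1) ^ 2) *
            gf (P1 @ (p, tl Y) # P2 @ M @ Q))"
        using False by (intro lin_cong) (auto simp: peel_block_def B Wt_content)
      also have "\<dots> = 0"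
        unfolding lin_add lin_mult using IH[of "butlast Y"] IH[of "tl Y"] False by simp
      finally show ?thesis .
    qed
    with Cons show ?case by (simp add: lin_add)
  qed simp
  have right: "lin L (\<lambda>M. peel (P @ M @ Q1) Q2 []) = 0" if "Q1 @ Q2 = Q" for Q1 Q2
    using that
  proof (induction Q2 arbitrary: Q1)
    case (Cons B Q2)
    obtain p Y where B: "B = (p, Y)" by fastforce
    have "lin L (\<lambda>M. peel_block (P @ M @ Q1) B Q2) = 0"
    proof (cases "Y = []")
      case True
      then show ?thesis by (simp add: peel_block_def B)
    next
      case False
      have IH: "lin L (\<lambda>M. gf (P @ M @ Q1 @ (p, Y') # Q2)) = 0" if "length Y' < length Y" for Y'
        using less(1)[of P "Q1 @ (p, Y') # Q2"] less(2) that Cons.prems B by auto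
      have "lin L (\<lambda>M. peel_block (P @ M @ Q1) B Q2) = lin L (\<lambda>M.
          Wt (last Y) (cols Q2) * gf (P @ M @ Q1 @ (p, butlast Y) # Q2) +
          (if p then 0 else Wt (hd Y) (tl Y @ cols Q2) * Wt (hd Y) (cols P @ ds @ cols Q1) ^ 2) *
            gf (P @ M @ Q1 @ (p, tl Y) # Q2))"
        using False by (intro lin_cong) (auto simp: peel_block_def B Wt_content)
      also have "\<dots> = 0"
        unfolding lin_add lin_mult using IH[of "butlast Y"] IH[of "tl Y"] False by simp
      finally show ?thesis .
    qed
    with Cons.IH[of "Q1 @ [B]"] Cons.prems show ?case by (simp add: lin_add)
  qed simp
  show ?case
  proof (cases "cols P @ ds @ cols Q = []")
    \<comment> \<open>With no positions left every \<open>gf\<close> is \<open>1\<close>, so the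
      relation says that the coefficients add up to \<open>0\<close>.\<close>
    case True
    have "lin L (\<lambda>M. gf (P @ M @ Q)) = lin L (\<lambda>M. 1)"
      using True content ds by (intro lin_cong gf_eq_1) auto
    then show ?thesis using nonempty True ds by simp
  next
    case False
    have "lin L (\<lambda>M. gf (P @ M @ Q)) =
        lin L (\<lambda>M. peel [] P (M @ Q) + (peel P M Q + peel (P @ M @ []) Q []))"
    proof (rule lin_cong)
      fix k M assume "(k, M) \<in> set L"
      then have "mset (cols M) = mset ds" using content ds by simp
      then have "cols (P @ M @ Q) \<noteq> []" using False by auto
      then show "gf (P @ M @ Q) = peel [] P (M @ Q) + (peel P M Q + peel (P @ M @ []) Q [])"
        by (simp add: gf_peel peel_append)
    qed
    then show ?thesis
      using left[of "[]" P] right[of "[]" Q] local[OF less(2)] by (simp only: lin_add) simp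
  qed
qed

lemma gf_relation_anywhere:
  assumes "\<And>k M. (k, M) \<in> set L \<Longrightarrow> mset (cols M) = \<mu>"
    and "\<mu> \<noteq> {#} \<or> (\<Sum>(k, M)\<leftarrow>L. k) = 0"
    and "\<And>P Q. lin L (\<lambda>M. peel P M Q) = 0"
  shows "lin L (\<lambda>M. gf (P @ M @ Q)) = 0"
  by (rule gf_relation[where R = UNIV]) (use assms in auto)

text \<open>
  At the front, removing an entry \<open>N\<close> of largest absolute value and removing \<open>- N\<close> have the same
  weight relative to the right context. Hence their contributions may cancel each other, which \<open>gf_relation_anywhere\<close> does not allow.
\<close>
lemma gf_relation_front:
  assumes "\<And>k M. (k, M) \<in> set L \<Longrightarrow> mset (cols M) = \<mu>"
    and "\<mu> \<noteq> {#} \<or> (\<Sum>(k, M)\<leftarrow>L. k) = 0"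
    and "\<And>Q. lin L (\<lambda>M. peel [] M Q) = 0"
  shows "lin L (\<lambda>M. gf (M @ Q)) = 0"
proof -
  have "lin L (\<lambda>M. gf ([] @ M @ Q)) = 0"
    by (rule gf_relation[where R = "{[]}"]) (use assms in auto)
  then show ?thesis by simp
qed

text \<open>The case \<open>\<mu> = {#}\<close> of the relation principle: no entry can be removed
  from either side, and the coefficients \<open>1\<close> and \<open>- 1\<close> add up to
  \<open>0\<close>.\<close>

lemma gf_empty_block [simp]: "gf (P @ (p, []) # Q) = gf (P @ Q)"
proof -
  have "lin [(1, [(p, [])]), (- 1, [])] (\<lambda>M. gf (P @ M @ Q)) = 0"
    by (rule gf_relation_anywhere[where \<mu> = "{#}"]) (auto simp: peel_block_def)
  then show ?thesis by simp
qed

lemma gf_empty_block_Cons [simp]: "gf ((p, []) # Q) = gf Q"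
  using gf_empty_block[of "[]"] by simp

section \<open>Alternating blocks\<close>

fun alt :: "bool \<Rightarrow> nat \<Rightarrow> bool list" where
  "alt c 0 = []"
| "alt c (Suc k) = c # alt (\<not> c) k"

lemma alt_eq_Nil [simp]: "alt c k = [] \<longleftrightarrow> k = 0"
  by (cases k) auto

lemma alt_add: "alt c (k + l) = alt c k @ alt (c \<noteq> odd k) l"
  by (induction k arbitrary: c) (auto intro: arg_cong2[where f = alt])

lemma alt_Suc_snoc: "alt c (Suc k) = alt c k @ [c \<noteq> odd k]"
  using alt_add[of c k 1] by simp

lemma last_alt: "last (alt c (Suc k)) = (c \<noteq> odd k)"
  and butlast_alt: "butlast (alt c (Suc k)) = alt c k"
  by (simp_all only: alt_Suc_snoc last_snoc butlast_snoc)

declare alt.simps(2) [simp del]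

lemma add_mset_both_colours [simp]:
  "add_mset c (add_mset (\<not> c) A) = add_mset False (add_mset True A)"
  "add_mset (\<not> c) (add_mset c A) = add_mset False (add_mset True A)"
  by (cases c; simp add: add_mset_commute)+

lemma mset_alt_even [simp]: "mset (alt c (2 * a)) = replicate_mset a True + replicate_mset a False"
  by (induction a; cases c) (auto simp: alt.simps)

lemma mset_alt_odd [simp]:
  "mset (alt c (Suc (2 * a))) = add_mset c (replicate_mset a True + replicate_mset a False)"
  by (simp add: alt.simps)

lemma mset_alt_even' [simp]: "mset (alt c (Suc (Suc (2 * a)))) =
   replicate_mset (Suc a) True + replicate_mset (Suc a) False"
  using mset_alt_even[of c "Suc a"] by simp

lemma wt_same [simp]: "wt c c = - 1" and wt_diff [simp]: "wt c (\<not> c) = - X" "wt (\<not> c) c = - X"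
  by (auto simp: wt_def)

text \<open>Two neighbouring positions of an alternating list contribute
  \<open>(- 1) * (- X) = X\<close>, whatever the colour \<open>c\<close>.\<close>

lemma Wt_alt_even [simp]: "Wt c (alt d (2 * a)) = X ^ a"
  by (induction a) (auto simp: wt_def alt.simps)

lemma Wt_alt_even' [simp]: "Wt c (alt d (Suc (Suc (2 * a)))) = X * X ^ a"
  using Wt_alt_even[of c d "Suc a"] by simp

lemma Wt_alt_odd [simp]: "Wt c (alt c (Suc (2 * a))) = - (X ^ a)"
  "Wt (\<not> c) (alt c (Suc (2 * a))) = - (X * X ^ a)" "Wt c (alt (\<not> c) (Suc (2 * a))) = - (X * X ^ a)"
  by (simp_all add: alt.simps)

abbreviation B :: "bool \<Rightarrow> nat \<Rightarrow> bool \<times> bool list" where "B c k \<equiv> (False, alt c k)"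
abbreviation D :: "bool \<Rightarrow> nat \<Rightarrow> bool \<times> bool list" where "D c k \<equiv> (True, alt c k)"
abbreviation S :: "bool \<Rightarrow> bool \<times> bool list" where "S c \<equiv> (False, [c])"

text \<open>Alternating blocks are closed under the recursion: removing either end leaves an
  alternating block, and removing the first position flips the starting colour.\<close>

lemma peel_block_alt:
  "peel_block P (p, alt c (Suc k)) Q =
     Wt (c \<noteq> odd k) (cols Q) * gf (P @ (p, alt c k) # Q) +
     (if p then 0 else Wt c (alt (\<not> c) k) * Wt c (cols Q) * Wt c (cols P) ^ 2 *
       gf (P @ B (\<not> c) k # Q))"
proof -
  have "hd (alt c (Suc k)) = c" "tl (alt c (Suc k)) = alt (\<not> c) k"
    by (simp_all add: alt.simps)
  then show ?thesis by (simp add: peel_block_def last_alt butlast_alt)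
qed

lemma peel_block_single:
  "peel_block P (S c) Q = Wt c (cols Q) * (1 + Wt c (cols P) ^ 2) * gf (P @ Q)"
  by (simp add: peel_block_def algebra_simps)

text \<open>The four relations are proved together because removing an end of the block leads to the
  relations for blocks one position shorter. The relations for length \<open>2 * a\<close> give
  those for \<open>2 * a + 1\<close> by \<open>odd_step\<close>, and these give the ones for the
  next even length.\<close>

lemma B_times_single:
  "gf (P @ B c (2 * a) # S c # Q) = gf (P @ B c (Suc (2 * a)) # Q) \<and>
   gf (P @ B c (2 * a) # S (\<not> c) # Q) = X ^ a * gf (P @ B (\<not> c) (Suc (2 * a)) # Q) \<and>
   gf (P @ B c (Suc (2 * a)) # S c # Q) = 0 \<and>
   gf (P @ B c (Suc (2 * a)) # S (\<not> c) # Q) =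
     gf (P @ B c (Suc (Suc (2 * a))) # Q) - X ^ Suc a * gf (P @ B (\<not> c) (Suc (Suc (2 * a))) # Q)"
proof (induction a arbitrary: c P Q)
  have odd_step: "gf (P @ B c (Suc (2 * a)) # S c # Q) = 0 \<and>
     gf (P @ B c (Suc (2 * a)) # S (\<not> c) # Q) =
       gf (P @ B c (Suc (Suc (2 * a))) # Q) - X ^ Suc a * gf (P @ B (\<not> c) (Suc (Suc (2 * a))) # Q)"
    if even_step: "\<And>c P Q. gf (P @ B c (2 * a) # S c # Q) = gf (P @ B c (Suc (2 * a)) # Q)"
      "\<And>c P Q. gf (P @ B c (2 * a) # S (\<not> c) # Q) = X ^ a * gf (P @ B (\<not> c) (Suc (2 * a)) # Q)"
    for a c P Q
  proof -
    \<comment> \<open>The instance for the block that starts with \<open>\<not> c\<close>, as it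
      remains after the first position has been removed.\<close>
    note even_step' = even_step(2)[of _ "\<not> c" for c, simplified]
    have "lin [(1, [B c (Suc (2 * a)), S c])] (\<lambda>M. gf (P @ M @ Q)) = 0"
      by (rule gf_relation_anywhere[where \<mu> = "mset (alt c (Suc (2 * a)) @ [c])"],
        auto simp: peel_block_alt peel_block_single even_step even_step')
        (simp_all add: algebra_simps power2_eq_square)
    moreover have "lin [(1, [B c (Suc (2 * a)), S (\<not> c)]), (- 1, [B c (Suc (Suc (2 * a)))]),
        (X ^ Suc a, [B (\<not> c) (Suc (Suc (2 * a)))])] (\<lambda>M. gf (P @ M @ Q)) = 0"
      by (rule gf_relation_anywhere[where \<mu> = "mset (alt c (Suc (2 * a)) @ [\<not> c])"],
        auto simp: peel_block_alt peel_block_single even_step even_step')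
        (simp_all add: algebra_simps power2_eq_square)
    ultimately show ?thesis by (simp add: algebra_simps)
  qed
  {
    case 0
    \<comment> \<open>For \<open>a = 0\<close> the block is empty and \<open>X ^ 0 = 1\<close>, so
      both relations for even length are immediate.\<close>
    show ?case using odd_step[of 0 P c Q] by (simp add: alt.simps)
  next
    case (Suc a)
    have odd: "gf (P @ B c (Suc (2 * a)) # S c # Q) = 0"
      "gf (P @ B c (Suc (2 * a)) # S (\<not> c) # Q) =
        gf (P @ B c (Suc (Suc (2 * a))) # Q) - X ^ Suc a * gf (P @ B (\<not> c) (Suc (Suc (2 * a))) # Q)"
      "gf (P @ B (\<not> c) (Suc (2 * a)) # S c # Q) =
        gf (P @ B (\<not> c) (Suc (Suc (2 * a))) # Q) - X ^ Suc a * gf (P @ B c (Suc (Suc (2 * a))) # Q)"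
      for c P Q
      using Suc[of P c Q] Suc[of P "\<not> c" Q] by simp_all
    have even: "gf (P @ B c (2 * Suc a) # S c # Q) = gf (P @ B c (Suc (2 * Suc a)) # Q)"
      "gf (P @ B c (2 * Suc a) # S (\<not> c) # Q) = X ^ Suc a * gf (P @ B (\<not> c) (Suc (2 * Suc a)) # Q)"
      for c P Q
    proof -
      have "lin [(1, [B c (2 * Suc a), S c]), (- 1, [B c (Suc (2 * Suc a))])] (\<lambda>M. gf (P @ M @ Q)) = 0"
        by (rule gf_relation_anywhere[where \<mu> = "mset (alt c (2 * Suc a) @ [c])"],
          auto simp: peel_block_alt peel_block_single odd mset_alt_odd[of _ "Suc a", simplified])
          (simp_all add: algebra_simps power2_eq_square)
      then show "gf (P @ B c (2 * Suc a) # S c # Q) = gf (P @ B c (Suc (2 * Suc a)) # Q)"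
        by simp
      have "lin [(1, [B c (2 * Suc a), S (\<not> c)]), (- (X ^ Suc a), [B (\<not> c) (Suc (2 * Suc a))])]
          (\<lambda>M. gf (P @ M @ Q)) = 0"
        by (rule gf_relation_anywhere[where \<mu> = "mset (alt c (2 * Suc a) @ [\<not> c])"],
          auto simp: peel_block_alt peel_block_single odd mset_alt_odd[of _ "Suc a", simplified])
          (simp_all add: algebra_simps power2_eq_square)
      then show "gf (P @ B c (2 * Suc a) # S (\<not> c) # Q) =
          X ^ Suc a * gf (P @ B (\<not> c) (Suc (2 * Suc a)) # Q)"
        by simp
    qed
    show ?case using even[of P c Q] odd_step[of "Suc a" P c Q] even by blast
  }
qed

text \<open>The induction of \<open>B_times_single\<close>, now for a positive block at the front.
  There \<open>1\<close> and \<open>(X ^ k)\<^sup>2\<close> are the relative weights of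
  \<open>N\<close> and \<open>- N\<close> on a single position of colour \<open>c\<close> behind the
  block of length \<open>2 * k\<close>. A positive block loses entries only at its end, so no
  relation between the starting colours \<open>c\<close> and \<open>\<not> c\<close> is lost in the
  process.\<close>

lemma D_times_single:
  "gf (D c (2 * k) # S c # Q) = (1 + (X ^ k)\<^sup>2) * gf (D c (Suc (2 * k)) # Q) \<and>
   gf (D c (2 * k) # S (\<not> c) # Q) = 2 * X ^ k * gf (D (\<not> c) (Suc (2 * k)) # Q) \<and>
   gf (D c (Suc (2 * k)) # S c # Q) = 0 \<and>
   gf (D c (Suc (2 * k)) # S (\<not> c) # Q) =
     (1 + (X ^ Suc k)\<^sup>2) * gf (D c (Suc (Suc (2 * k))) # Q)
       - 2 * X ^ Suc k * gf (D (\<not> c) (Suc (Suc (2 * k))) # Q)"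
proof (induction k arbitrary: c Q)
  have odd_step: "gf (D c (Suc (2 * k)) # S c # Q) = 0 \<and>
     gf (D c (Suc (2 * k)) # S (\<not> c) # Q) =
       (1 + (X ^ Suc k)\<^sup>2) * gf (D c (Suc (Suc (2 * k))) # Q)
         - 2 * X ^ Suc k * gf (D (\<not> c) (Suc (Suc (2 * k))) # Q)"
    if even_step: "\<And>c Q. gf (D c (2 * k) # S c # Q) = (1 + (X ^ k)\<^sup>2) * gf (D c (Suc (2 * k)) # Q)"
      "\<And>c Q. gf (D c (2 * k) # S (\<not> c) # Q) = 2 * X ^ k * gf (D (\<not> c) (Suc (2 * k)) # Q)"
    for k c Q
  proof -
    note even_step' = even_step(2)[of "\<not> c" for c, simplified]
    have "lin [(1, [D c (Suc (2 * k)), S c])] (\<lambda>M. gf (M @ Q)) = 0"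
      by (rule gf_relation_front[where \<mu> = "mset (alt c (Suc (2 * k)) @ [c])"],
        auto simp: peel_block_alt peel_block_single even_step even_step')
        (simp_all add: algebra_simps power2_eq_square)?
    moreover have "lin [(1, [D c (Suc (2 * k)), S (\<not> c)]),
        (- (1 + (X ^ Suc k)\<^sup>2), [D c (Suc (Suc (2 * k)))]),
        (2 * X ^ Suc k, [D (\<not> c) (Suc (Suc (2 * k)))])] (\<lambda>M. gf (M @ Q)) = 0"
      by (rule gf_relation_front[where \<mu> = "mset (alt c (Suc (2 * k)) @ [\<not> c])"],
        auto simp: peel_block_alt peel_block_single even_step even_step')
        (simp_all add: algebra_simps power2_eq_square)?
    ultimately show ?thesis by (simp add: algebra_simps)
  qed
  {
    case 0
    \<comment> \<open>The sign of an entry at the front is free and does not affect the weight, so a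
      single position there counts twice as much as a positive one.\<close>
    have "lin [(1, [S c]), (- 2, [D c 1])] (\<lambda>M. gf (M @ Q)) = 0" for c Q
      by (rule gf_relation_front[where \<mu> = "{#c#}"],
        auto simp: peel_block_alt peel_block_single alt.simps)
        (simp_all add: peel_block_def)?
    then have single: "gf (S c # Q) = 2 * gf (D c (Suc 0) # Q)" for c Q by simp
    show ?case using odd_step[of 0 c Q] by (simp add: single)
  next
    case (Suc k)
    have odd: "gf (D c (Suc (2 * k)) # S c # Q) = 0"
      "gf (D c (Suc (2 * k)) # S (\<not> c) # Q) =
        (1 + (X ^ Suc k)\<^sup>2) * gf (D c (Suc (Suc (2 * k))) # Q)
          - 2 * X ^ Suc k * gf (D (\<not> c) (Suc (Suc (2 * k))) # Q)"
      "gf (D (\<not> c) (Suc (2 * k)) # S c # Q) =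
        (1 + (X ^ Suc k)\<^sup>2) * gf (D (\<not> c) (Suc (Suc (2 * k))) # Q)
          - 2 * X ^ Suc k * gf (D c (Suc (Suc (2 * k))) # Q)"
      for c Q
      using Suc[of c Q] Suc[of "\<not> c" Q] by simp_all
    have even: "gf (D c (2 * Suc k) # S c # Q) = (1 + (X ^ Suc k)\<^sup>2) * gf (D c (Suc (2 * Suc k)) # Q)"
      "gf (D c (2 * Suc k) # S (\<not> c) # Q) = 2 * X ^ Suc k * gf (D (\<not> c) (Suc (2 * Suc k)) # Q)"
      for c Q
    proof -
      have "lin [(1, [D c (2 * Suc k), S c]), (- (1 + (X ^ Suc k)\<^sup>2), [D c (Suc (2 * Suc k))])]
          (\<lambda>M. gf (M @ Q)) = 0"
        by (rule gf_relation_front[where \<mu> = "mset (alt c (2 * Suc k) @ [c])"],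
          auto simp: peel_block_alt peel_block_single odd mset_alt_odd[of _ "Suc k", simplified])
          (simp_all add: algebra_simps power2_eq_square)?
      then show "gf (D c (2 * Suc k) # S c # Q) = (1 + (X ^ Suc k)\<^sup>2) * gf (D c (Suc (2 * Suc k)) # Q)"
        by (simp add: algebra_simps)
      have "lin [(1, [D c (2 * Suc k), S (\<not> c)]), (- (2 * X ^ Suc k), [D (\<not> c) (Suc (2 * Suc k))])]
          (\<lambda>M. gf (M @ Q)) = 0"
        by (rule gf_relation_front[where \<mu> = "mset (alt c (2 * Suc k) @ [\<not> c])"],
          auto simp: peel_block_alt peel_block_single odd mset_alt_odd[of _ "Suc k", simplified])
          (simp_all add: algebra_simps power2_eq_square)?
      then show "gf (D c (2 * Suc k) # S (\<not> c) # Q) =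
          2 * X ^ Suc k * gf (D (\<not> c) (Suc (2 * Suc k)) # Q)"
        by (simp add: algebra_simps)
    qed
    show ?case using even[of c Q] odd_step[of "Suc k" c Q] even by blast
  }
qed

section \<open>Single positions behind the leading block\<close>

definition singles :: "bool \<Rightarrow> nat \<Rightarrow> shape" where
  "singles c r = map S (alt c r)"

lemma singles_simps [simp]: "singles c 0 = []" "singles c (Suc r) = S c # singles (\<not> c) r"
  by (simp_all add: singles_def alt.simps)

lemma singles_add: "singles c (k + l) = singles c k @ singles (c \<noteq> odd k) l"
  by (simp add: singles_def alt_add)

lemma singles_snoc: "singles c (Suc k) = singles c k @ [S (c \<noteq> odd k)]"
  by (simp add: singles_def alt_Suc_snoc del: alt.simps)

definition factor :: "nat \<Rightarrow> int poly" where
  "factor j = 1 + monom ((- 1) ^ (j - 1)) (j div 2)"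

lemma X_power: "X ^ n = monom 1 n"
  by (simp add: X_def monom_power)

text \<open>The indices \<open>2 * k + 2\<close> and \<open>2 * k + 3\<close> share the exponent
  \<open>k + 1\<close> and differ in sign, which lets the product be built two factors at a
  time.\<close>

lemma factor_even: "factor (Suc (Suc (2 * k))) = 1 - X ^ Suc k"
  and factor_odd: "factor (Suc (Suc (Suc (2 * k)))) = 1 + X ^ Suc k"
  unfolding X_power by (simp_all add: factor_def minus_monom[symmetric] del: minus_monom)

text \<open>The only filling is \<open>1\<close>, ..., \<open>k\<close> in this order, and it has no
  inversions of either kind.\<close>

lemma gf_D: "gf [D c k] = 1"
proof (induction k)
  case (Suc k)
  then show ?case by (simp add: gf_peel peel_block_alt)
qed (simp add: gf_eq_1)

text \<open>Two single positions are absorbed at a time, so the leading block keeps odd length. A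
  single remaining position gives \<open>(1 + y\<^sup>2) - 2 * y = (1 - y)\<^sup>2\<close>.\<close>

lemma gf_D_odd_singles:
  "gf (D c (Suc (2 * k)) # singles (\<not> c) r) = (\<Prod>j = 2 * k + 2..2 * k + 1 + r. factor j ^ 2)"
proof (induction r arbitrary: k rule: less_induct)
  case (less r)
  consider "r = 0" | "r = 1" | s where "r = Suc (Suc s)" by (metis One_nat_def not0_implies_Suc)
  then show ?case
  proof cases
    case 1
    then show ?thesis by (simp add: gf_D)
  next
    case 2
    then show ?thesis
      using D_times_single[of c k "[]"] factor_even[of k]
      by (simp add: gf_D) (simp add: algebra_simps power2_eq_square)
  next
    case 3
    let ?y = "X ^ Suc k" and ?Q = "singles (\<not> c) s"
    have "gf (D c (Suc (2 * k)) # singles (\<not> c) r) = (1 + ?y\<^sup>2) * gf (D c (2 * Suc k) # S c # ?Q)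
        - 2 * ?y * gf (D (\<not> c) (2 * Suc k) # S c # ?Q)"
      using D_times_single[of c k "S c # ?Q"] 3 by simp
    also have "\<dots> = ((1 + ?y\<^sup>2)\<^sup>2 - (2 * ?y)\<^sup>2) * gf (D c (Suc (2 * Suc k)) # ?Q)"
      using D_times_single[of c "Suc k" ?Q] D_times_single[of "\<not> c" "Suc k" ?Q]
      by (simp add: algebra_simps power2_eq_square)
    \<comment> \<open>A difference of squares: the two squared factors are those with indices
      \<open>2 * k + 2\<close> and \<open>2 * k + 3\<close>.\<close>
    also have "\<dots> = (1 - ?y)\<^sup>2 * (1 + ?y)\<^sup>2 * (\<Prod>j = 2 * Suc k + 2..2 * Suc k + 1 + s. factor j ^ 2)"
      using less[of s "Suc k"] 3 by (simp add: algebra_simps power2_eq_square)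
    also have "\<dots> = (\<Prod>j = 2 * k + 2..2 * k + 1 + r. factor j ^ 2)"
    proof -
      have "{2 * k + 2..2 * k + 1 + r} = insert (Suc (Suc (2 * k)))
          (insert (Suc (Suc (Suc (2 * k)))) {2 * Suc k + 2..2 * Suc k + 1 + s})"
        using 3 by auto
      then show ?thesis using factor_even[of k] factor_odd[of k] by simp
    qed
    finally show ?thesis .
  qed
qed

section \<open>Expansion of alternating blocks into single positions\<close>

definition block_denom :: "nat \<Rightarrow> int poly" where
  "block_denom b = (\<Prod>k = 1..b div 2. 1 - (X ^ k)\<^sup>2)"

lemma gf_equal_singles: "gf (P @ S c # S c # Q) = 0"
  using B_times_single[of P c 0 Q] by (simp add: alt.simps)

text \<open>The relations for an odd block followed by the other colour, taken for \<open>c\<close>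
  and \<open>\<not> c\<close>, are two linear equations for the two even blocks. Their determinant
  \<open>1 - (X ^ Suc a)\<^sup>2\<close> is the new factor of \<open>block_denom\<close>. A further
  single position then gives the next odd length.\<close>

lemma gf_block_singles:
  "block_denom (2 * a) * gf (P @ B c (Suc (2 * a)) # Q) = gf (P @ singles c (Suc (2 * a)) @ Q) \<and>
   block_denom (2 * Suc a) * gf (P @ B c (2 * Suc a) # Q) =
     gf (P @ singles c (2 * Suc a) @ Q) + X ^ Suc a * gf (P @ singles (\<not> c) (2 * Suc a) @ Q)"
proof (induction a arbitrary: P c Q)
  have even_step: "block_denom (2 * Suc a) * gf (P @ B c (2 * Suc a) # Q) =
     gf (P @ singles c (2 * Suc a) @ Q) + X ^ Suc a * gf (P @ singles (\<not> c) (2 * Suc a) @ Q)"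
    if odd: "\<And>c Q. block_denom (2 * a) * gf (P @ B c (Suc (2 * a)) # Q) =
      gf (P @ singles c (Suc (2 * a)) @ Q)" for a P c Q
  proof -
    let ?y = "X ^ Suc a"
    have "(1 - ?y\<^sup>2) * gf (P @ B c (2 * Suc a) # Q) =
        gf (P @ B c (Suc (2 * a)) # S (\<not> c) # Q) + ?y * gf (P @ B (\<not> c) (Suc (2 * a)) # S c # Q)"
      using B_times_single[of P c a Q] B_times_single[of P "\<not> c" a Q]
      by simp (simp add: algebra_simps power2_eq_square)
    moreover have "block_denom (2 * Suc a) * gf (P @ B c (2 * Suc a) # Q) =
        block_denom (2 * a) * ((1 - ?y\<^sup>2) * gf (P @ B c (2 * Suc a) # Q))"
      by (simp add: block_denom_def)
    ultimately have "block_denom (2 * Suc a) * gf (P @ B c (2 * Suc a) # Q) =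
        block_denom (2 * a) * gf (P @ B c (Suc (2 * a)) # S (\<not> c) # Q) +
        ?y * (block_denom (2 * a) * gf (P @ B (\<not> c) (Suc (2 * a)) # S c # Q))"
      by (simp only: distrib_left mult.left_commute)
    then show ?thesis
      using singles_snoc[of c "Suc (2 * a)"] singles_snoc[of "\<not> c" "Suc (2 * a)"]
      by (simp add: odd del: singles_simps(2))
  qed
  {
    case 0
    have "block_denom (2 * 0) * gf (P @ B c (Suc (2 * 0)) # Q) = gf (P @ singles c (Suc (2 * 0)) @ Q)"
      for c Q by (simp add: block_denom_def alt.simps)
    then show ?case using even_step[of 0] by blast
  next
    case (Suc a)
    have "block_denom (2 * Suc a) * gf (P @ B c (Suc (2 * Suc a)) # Q) =
        gf (P @ singles c (Suc (2 * Suc a)) @ Q)" for c Q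
    proof -
      \<comment> \<open>The second term of the even expansion ends in colour \<open>c\<close>, so it
        vanishes next to the appended \<open>S c\<close>.\<close>
      have "singles (\<not> c) (2 * Suc a) = singles (\<not> c) (Suc (2 * a)) @ [S c]"
        using singles_snoc[of "\<not> c" "Suc (2 * a)"] by simp
      then have "gf (P @ singles (\<not> c) (2 * Suc a) @ S c # Q) = 0"
        using gf_equal_singles[of "P @ singles (\<not> c) (Suc (2 * a))" c Q] by simp
      then show ?thesis
        using Suc[of P c "S c # Q"] B_times_single[of P c "Suc a" Q] singles_snoc[of c "2 * Suc a"]
        by (simp del: singles_simps(2) mult_Suc_right)
    qed
    then show ?case using even_step[of "Suc a"] by blast
  }
qed

text \<open>Colours alternate across block boundaries as positions do, and this determines the
  starting colour of every block.\<close>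

fun blocks :: "bool \<Rightarrow> nat list \<Rightarrow> shape" where
  "blocks c [] = []"
| "blocks c (b # bs) = B c b # blocks (c \<noteq> odd b) bs"

lemma positive_even_cases:
  fixes b :: nat
  assumes "even b" "0 < b"
  obtains a where "b = 2 * Suc a"
proof -
  from \<open>even b\<close> obtain m where "b = 2 * m" by (rule evenE)
  with \<open>0 < b\<close> show thesis using that[of "m - 1"] by simp
qed

text \<open>The second term in the expansion of an even block starts with \<open>\<not> c\<close>,
  the colour of the single position before it, and therefore vanishes. The surviving term ends in
  \<open>\<not> c\<close> again, so the next block meets the same situation.\<close>

lemma gf_single_even_blocks:
  assumes "\<forall>b\<in>set bs. 0 < b \<and> even b"
  shows "(\<Prod>b\<leftarrow>bs. block_denom b) * gf (P @ S (\<not> c) # blocks c bs @ Q) =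
    gf (P @ S (\<not> c) # singles c (sum_list bs) @ Q)"
  using assms
proof (induction bs arbitrary: P)
  case (Cons b bs)
  then have "even b" "0 < b" by simp_all
  then obtain a where b: "b = 2 * Suc a" by (rule positive_even_cases)
  let ?K = "\<Prod>b\<leftarrow>bs. block_denom b" and ?P = "P @ S (\<not> c) # singles c (Suc (2 * a))"
  have "gf ((P @ [S (\<not> c)]) @ singles (\<not> c) b @ blocks c bs @ Q) = 0"
    using gf_equal_singles[of P "\<not> c" "singles c (Suc (2 * a)) @ blocks c bs @ Q"] b by simp
  then have A: "block_denom b * gf (P @ S (\<not> c) # B c b # blocks c bs @ Q) =
      gf ((P @ [S (\<not> c)]) @ singles c b @ blocks c bs @ Q)"
    using gf_block_singles[of a "P @ [S (\<not> c)]" c "blocks c bs @ Q"]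
    unfolding b by (simp del: singles_simps(2) mult_Suc_right)
  have sing: "singles c b = singles c (Suc (2 * a)) @ [S (\<not> c)]"
    using singles_snoc[of c "Suc (2 * a)"] b by simp
  have "(\<Prod>b\<leftarrow>b # bs. block_denom b) * gf (P @ S (\<not> c) # blocks c (b # bs) @ Q) =
      ?K * (block_denom b * gf (P @ S (\<not> c) # B c b # blocks c bs @ Q))"
    using Cons.prems by simp
  also have "\<dots> = ?K * gf (?P @ S (\<not> c) # blocks c bs @ Q)"
    unfolding A sing by (simp del: singles_simps(2))
  also have "\<dots> = gf (?P @ S (\<not> c) # singles c (sum_list bs) @ Q)"
    using Cons.IH[of ?P] Cons.prems by (simp del: singles_simps(2))
  also have "\<dots> = gf (P @ S (\<not> c) # singles c (sum_list (b # bs)) @ Q)"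
    using sing b singles_add[of c b "sum_list bs"] by (simp del: singles_simps(2))
  finally show ?case .
qed simp

text \<open>One odd block removes the second terms of all even blocks. An even block behind it is
  treated by \<open>gf_single_even_blocks\<close>; an even block before it is expanded after
  everything on its right has become single positions.\<close>

lemma gf_blocks:
  assumes "\<forall>b\<in>set bs. 0 < b" and "\<exists>b\<in>set bs. odd b"
  shows "(\<Prod>b\<leftarrow>bs. block_denom b) * gf (P @ blocks c bs @ Q) = gf (P @ singles c (sum_list bs) @ Q)"
  using assms
proof (induction bs arbitrary: P c)
  case (Cons b bs)
  let ?K = "\<Prod>b\<leftarrow>bs. block_denom b"
  show ?case
  proof (cases "odd b")
    case True
    then obtain a where b: "b = Suc (2 * a)" by (auto elim: oddE)
    have *: "?K * gf ((P @ singles c b) @ blocks (\<not> c) bs @ Q) =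
        gf ((P @ singles c b) @ singles (\<not> c) (sum_list bs) @ Q)"
    proof (cases "\<exists>b\<in>set bs. odd b")
      case True
      then show ?thesis using Cons.IH[of "P @ singles c b" "\<not> c"] Cons.prems(1) by simp
    next
      case False
      have "singles c b = singles c (2 * a) @ [S c]" using singles_snoc[of c "2 * a"] b by simp
      then show ?thesis
        using gf_single_even_blocks[of bs "P @ singles c (2 * a)" "\<not> c" Q] False Cons.prems by simp
    qed
    have "(\<Prod>b\<leftarrow>b # bs. block_denom b) * gf (P @ blocks c (b # bs) @ Q) =
        ?K * (block_denom (2 * a) * gf (P @ B c (Suc (2 * a)) # blocks (\<not> c) bs @ Q))"
      unfolding b by (simp add: block_denom_def)
    also have "\<dots> = ?K * gf ((P @ singles c b) @ blocks (\<not> c) bs @ Q)"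
      using gf_block_singles[of a P c "blocks (\<not> c) bs @ Q"] unfolding b
      by (simp del: singles_simps(2))
    also have "\<dots> = gf (P @ singles c (sum_list (b # bs)) @ Q)"
      unfolding * using singles_add[of c b "sum_list bs"] True by simp
    finally show ?thesis .
  next
    case False
    then have "even b" "0 < b" using Cons.prems by simp_all
    then obtain a where b: "b = 2 * Suc a" by (rule positive_even_cases)
    have odd: "\<exists>b\<in>set bs. odd b" using Cons.prems False by auto
    then have "sum_list bs \<noteq> 0" using Cons.prems by (auto simp: sum_list_eq_0_iff)
    then obtain s where s: "sum_list bs = Suc s" by (rule not0_implies_Suc[THEN exE])
    have IH: "?K * gf (P @ singles d b @ blocks c bs @ Q) =
        gf (P @ singles d b @ singles c (sum_list bs) @ Q)" for d
      using Cons.IH[of "P @ singles d b" c] odd Cons.prems by simp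
    have "singles (\<not> c) b = singles (\<not> c) (Suc (2 * a)) @ [S c]"
      using singles_snoc[of "\<not> c" "Suc (2 * a)"] b by simp
    \<comment> \<open>The second term ends in \<open>c\<close>, the colour with which the single
      positions on the right begin. They exist because \<open>bs\<close> contains an odd
      block.\<close>
    then have zero: "gf (P @ singles (\<not> c) b @ singles c (sum_list bs) @ Q) = 0"
      using gf_equal_singles[of "P @ singles (\<not> c) (Suc (2 * a))" c "singles (\<not> c) s @ Q"] s
      by (simp del: singles_simps(2)) (simp add: singles_simps(2)[of c])
    have "(\<Prod>b\<leftarrow>b # bs. block_denom b) * gf (P @ blocks c (b # bs) @ Q) =
        ?K * (block_denom (2 * Suc a) * gf (P @ B c (2 * Suc a) # blocks c bs @ Q))"
      unfolding b by simp
    also have "\<dots> = ?K * gf (P @ singles c b @ blocks c bs @ Q) +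
        X ^ Suc a * (?K * gf (P @ singles (\<not> c) b @ blocks c bs @ Q))"
      using gf_block_singles[of a P c "blocks c bs @ Q"] unfolding b
      by (simp del: singles_simps(2) mult_Suc_right power_Suc add: algebra_simps)
    also have "\<dots> = gf (P @ singles c (sum_list (b # bs)) @ Q)"
      unfolding IH zero using singles_add[of c b "sum_list bs"] False by simp
    finally show ?thesis .
  qed
qed simp

text \<open>The expanded positions are absorbed by the leading block. If \<open>a\<close> is even,
  the first of them has the starting colour \<open>c\<close> and contributes the extra factor; from
  then on the leading block has odd length.\<close>

lemma gf_D_blocks:
  assumes "\<forall>b\<in>set bs. 0 < b" and "\<exists>b\<in>set bs. odd b"
  shows "(\<Prod>b\<leftarrow>bs. block_denom b) * gf (D c a # blocks (c \<noteq> odd a) bs) =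
    (if even a then 1 + (X ^ (a div 2))\<^sup>2 else 1) *
    (\<Prod>j = 2 * (a div 2) + 2..a + sum_list bs. factor j ^ 2)"
proof -
  have "sum_list bs \<noteq> 0" using assms by (auto simp: sum_list_eq_0_iff)
  then obtain r where r: "sum_list bs = Suc r" by (rule not0_implies_Suc[THEN exE])
  have "(\<Prod>b\<leftarrow>bs. block_denom b) * gf (D c a # blocks (c \<noteq> odd a) bs) =
      gf (D c a # singles (c \<noteq> odd a) (sum_list bs))"
    using gf_blocks[OF assms, of "[D c a]" "c \<noteq> odd a" "[]"] by simp
  also have "\<dots> = (if even a then 1 + (X ^ (a div 2))\<^sup>2 else 1) *
    (\<Prod>j = 2 * (a div 2) + 2..a + sum_list bs. factor j ^ 2)"
  proof (cases "even a")
    case True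
    then obtain k where a: "a = 2 * k" by (rule evenE)
    show ?thesis
      using D_times_single[of c k "singles (\<not> c) r"] gf_D_odd_singles[of c k r] a r by simp
  next
    case False
    then obtain k where a: "a = Suc (2 * k)" by (auto elim: oddE)
    show ?thesis using gf_D_odd_singles[of c k "sum_list bs"] a by simp
  qed
  finally show ?thesis .
qed

section \<open>Cancellation of the denominators\<close>

lemma block_denom_nonzero: "block_denom b \<noteq> 0"
proof -
  have "1 - (X ^ k)\<^sup>2 \<noteq> 0" if "1 \<le> k" for k
  proof
    assume "1 - (X ^ k)\<^sup>2 = 0"
    then have "poly (1 - (X ^ k)\<^sup>2) 0 = 0" by simp
    then show False using that by (simp add: X_def poly_monom power_0_left)
  qed
  then show ?thesis by (simp add: block_denom_def)
qed

text \<open>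
  The witness is the generating function of a smaller shape: all blocks are shrunk to even size and
  only one or two singletons are kept. Both shapes have the same denominators.
\<close>
lemma gf_divisible:
  fixes c :: bool and a :: nat and bs :: "nat list"
  defines "m \<equiv> (a + 1) div 2 + (\<Sum>b\<leftarrow>bs. b div 2)"
  assumes pos: "\<forall>b\<in>set bs. 0 < b" and le: "2 * m + 2 \<le> a + sum_list bs"
  shows "\<exists>M. gf (D c a # blocks (c \<noteq> odd a) bs) =
    (if even a then 1 + (X ^ (a div 2))\<^sup>2 else 1) * M *
    (\<Prod>j = 2 * m + 2..a + sum_list bs. factor j ^ 2)"
proof -
  let ?G = "gf (D c a # blocks (c \<noteq> odd a) bs)" and ?K = "\<Prod>b\<leftarrow>bs. block_denom b"
  let ?E = "if even a then 1 + (X ^ (a div 2))\<^sup>2 else (1 :: int poly)"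
  let ?p = "\<lambda>l u. \<Prod>j = l..u. factor j ^ 2"
  \<comment> \<open>Rounding down to even length leaves \<open>b div 2\<close> and hence every
    \<open>block_denom\<close> unchanged. Blocks of length \<open>1\<close> become empty and are
    dropped.\<close>
  define ev where "ev = filter (\<lambda>b. 0 < b) (map (\<lambda>b. 2 * (b div 2)) bs)"
  \<comment> \<open>The number of singletons makes the total \<open>2 * m + 1\<close>, just below
    the first index of the product to be split off. A singleton also supplies the odd block that
    \<open>gf_D_blocks\<close> requires.\<close>
  define bs0 where "bs0 = (if even a then 1 # ev else 1 # 1 # ev)"
  have sum_bs: "sum_list bs = 2 * (\<Sum>b\<leftarrow>bs. b div 2)" if "\<forall>b\<in>set bs. even b"
    using that by (induction bs) auto
  \<comment> \<open>If all lengths in \<open>bs\<close> were even, there would be at most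
    \<open>2 * m\<close> positions.\<close>
  have odd: "\<exists>b\<in>set bs. odd b"
  proof (rule ccontr)
    assume "\<not> ?thesis"
    then show False using sum_bs le by (auto simp: m_def)
  qed
  have sum_ev: "sum_list ev = 2 * (\<Sum>b\<leftarrow>bs. b div 2)"
    unfolding ev_def by (induction bs) auto
  have K_ev: "(\<Prod>b\<leftarrow>ev. block_denom b) = ?K"
    unfolding ev_def by (induction bs) (auto simp: block_denom_def)
  have "block_denom 1 = 1" by (simp add: block_denom_def)
  then have K0: "(\<Prod>b\<leftarrow>bs0. block_denom b) = ?K" using K_ev by (simp add: bs0_def)
  have pos0: "\<forall>b\<in>set bs0. 0 < b" and odd0: "\<exists>b\<in>set bs0. odd b"
    by (auto simp: bs0_def ev_def)
  have n0: "a + sum_list bs0 = 2 * m + 1"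
    using sum_ev by (auto simp: bs0_def m_def elim!: evenE oddE)
  have nz: "?K \<noteq> 0" using block_denom_nonzero by (auto simp: prod_list_zero_iff)
  have ea: "2 * (a div 2) + 2 \<le> 2 * m + 2" by (auto simp: m_def)
  let ?H = "gf (D c a # blocks (c \<noteq> odd a) bs0)"
  have "?K * ?G = ?E * ?p (2 * (a div 2) + 2) (a + sum_list bs)"
    using gf_D_blocks[OF pos odd] .
  also have "\<dots> = ?E * ?p (2 * (a div 2) + 2) (2 * m + 1) * ?p (2 * m + 2) (a + sum_list bs)"
  proof -
    have "{2 * (a div 2) + 2..a + sum_list bs} =
        {2 * (a div 2) + 2..2 * m + 1} \<union> {2 * m + 2..a + sum_list bs}"
      using le ea by auto
    then show ?thesis by (simp add: prod.union_disjoint)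
  qed
  also have "\<dots> = ?K * ?H * ?p (2 * m + 2) (a + sum_list bs)"
    using gf_D_blocks[OF pos0 odd0, of c a] unfolding K0 n0 by simp
  finally have G: "?G = ?H * ?p (2 * m + 2) (a + sum_list bs)" using nz by simp
  \<comment> \<open>For even \<open>a\<close> the singleton at the head of \<open>bs0\<close> merges
    with the leading block and produces \<open>?E\<close>. This factor is displayed separately
    because for \<open>a = 0\<close> it is the \<open>2\<close> by which the sum over all signed
    permutations is later divided.\<close>
  have "\<exists>M. ?H = ?E * M"
  proof (cases "even a")
    case True
    then obtain k where a: "a = 2 * k" by (rule evenE)
    show ?thesis
      using D_times_single[of c k "blocks (\<not> c) ev"] a by (auto simp: bs0_def alt.simps)
  qed simp
  then show ?thesis using G by auto
qed

section \<open>Length and odd length as a product over pairs of positions\<close>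

definition weight :: "nat \<Rightarrow> (int \<Rightarrow> int) \<Rightarrow> int poly" where
  "weight n \<sigma> = word_wt (map (\<lambda>p. (\<sigma> (int p), odd p)) [1..<Suc n])"

lemma word_wt_upt:
  "word_wt (map f [1..<Suc n]) = (\<Prod>(i, j) \<in> {(i, j) \<in> {1..n} \<times> {1..n}. i < j}. pair_wt (f i) (f j))"
proof (induction n)
  case (Suc n)
  let ?S = "\<lambda>n::nat. {(i, j) \<in> {1..n} \<times> {1..n}. i < j}"
  have S: "?S (Suc n) = (\<lambda>i. (i, Suc n)) ` {1..n} \<union> ?S n" by auto
  have "finite (?S n)" by (rule finite_subset[of _ "{1..n} \<times> {1..n}"]) auto
  then have "(\<Prod>(i, j) \<in> ?S (Suc n). pair_wt (f i) (f j)) =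
      (\<Prod>(i, j) \<in> (\<lambda>i. (i, Suc n)) ` {1..n}. pair_wt (f i) (f j)) *
      (\<Prod>(i, j) \<in> ?S n. pair_wt (f i) (f j))"
    unfolding S by (intro prod.union_disjoint) auto
  also have "(\<Prod>(i, j) \<in> (\<lambda>i. (i, Suc n)) ` {1..n}. pair_wt (f i) (f j)) =
      (\<Prod>i\<in>{1..n}. pair_wt (f i) (f (Suc n)))"
    by (subst prod.reindex) (auto simp: inj_on_def)
  also have "\<dots> = (\<Prod>b\<leftarrow>map f [1..<Suc n]. pair_wt b (f (Suc n)))"
    by (simp add: prod.distinct_set_conv_list[symmetric] comp_def atLeastLessThanSuc_atLeastAtMost
        del: upt_Suc)
  also have "\<dots> * (\<Prod>(i, j) \<in> ?S n. pair_wt (f i) (f j)) = word_wt (map f [1..<Suc (Suc n)])"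
    using word_wt_insert[of "map f [1..<Suc n]" "f (Suc n)" "[]"] Suc
    by (simp del: upt_Suc add: upt_Suc_append)
  finally show ?case by simp
qed simp

lemma prod_wt:
  fixes R :: "nat \<Rightarrow> nat \<Rightarrow> bool"
  shows "(\<Prod>(i, j) \<in> {(i, j) \<in> {1..n} \<times> {1..n}. i < j}. if R i j then wt (odd i) (odd j) else 1) =
    (- 1) ^ card {(i, j) \<in> {1..n} \<times> {1..n}. i < j \<and> R i j} *
    X ^ card {(i, j) \<in> {1..n} \<times> {1..n}. i < j \<and> R i j \<and> i mod 2 \<noteq> j mod 2}"
    (is "prod _ ?S = (- 1) ^ card ?A * X ^ card ?B")
proof -
  have fin: "finite ?S" by (rule finite_subset[of _ "{1..n} \<times> {1..n}"]) auto
  have A: "?A = {p \<in> ?S. R (fst p) (snd p)}" by auto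
  have B: "?B = {p \<in> ?A. fst p mod 2 \<noteq> snd p mod 2}" by auto
  have finA: "finite ?A" unfolding A using fin by simp
  have "(\<Prod>(i, j) \<in> ?S. if R i j then wt (odd i) (odd j) else 1) =
      (\<Prod>p \<in> ?A. wt (odd (fst p)) (odd (snd p)))"
    unfolding A prod.inter_filter[OF fin] by (simp only: case_prod_unfold)
  also have "\<dots> = (\<Prod>p \<in> ?A. - 1 * (if fst p mod 2 \<noteq> snd p mod 2 then X else 1))"
  proof (rule prod.cong[OF refl])
    fix p :: "nat \<times> nat"
    have "odd (fst p) = odd (snd p) \<longleftrightarrow> fst p mod 2 = snd p mod 2" by presburger
    then show "wt (odd (fst p)) (odd (snd p)) =
        - 1 * (if fst p mod 2 \<noteq> snd p mod 2 then X else 1)"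
      by (auto simp: wt_def)
  qed
  also have "\<dots> = (\<Prod>p \<in> ?A. - 1) * (\<Prod>p \<in> ?B. X)"
    unfolding prod.distrib B prod.inter_filter[OF finA] ..
  finally show ?thesis by (simp add: prod_constant)
qed

lemma weight_eq: "weight n \<sigma> = monom ((- 1) ^ lengthD n \<sigma>) (odd_lengthD n \<sigma>)"
proof -
  let ?S = "{(i, j) \<in> {1..n} \<times> {1..n}. i < j}"
  have "weight n \<sigma> = (\<Prod>(i, j) \<in> ?S. if \<sigma> (int i) > \<sigma> (int j) then wt (odd i) (odd j) else 1) *
      (\<Prod>(i, j) \<in> ?S. if \<sigma> (int i) + \<sigma> (int j) < 0 then wt (odd i) (odd j) else 1)"
    unfolding weight_def word_wt_upt by (simp add: pair_wt_def case_prod_unfold prod.distrib cong: if_cong)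
  also have "\<dots> = (- 1) ^ lengthD n \<sigma> * X ^ odd_lengthD n \<sigma>"
    unfolding prod_wt lengthD_def odd_lengthD_def by (simp add: power_add)
  also have "(- 1) ^ lengthD n \<sigma> * X ^ odd_lengthD n \<sigma> =
      monom ((- 1) ^ lengthD n \<sigma>) (odd_lengthD n \<sigma>)"
    unfolding X_power by (cases "even (lengthD n \<sigma>)") (auto simp: minus_monom[symmetric])
  finally show ?thesis .
qed

section \<open>Signed permutations\<close>

text \<open>Composed on the left it changes the sign of the entry of absolute value
  \<open>1\<close>; composed on the right it changes the sign of the first entry of a signed
  permutation.\<close>

definition unit_flip :: "int \<Rightarrow> int" where
  "unit_flip x = (if \<bar>x\<bar> = 1 then - x else x)"

lemma unit_flip_flip [simp]: "unit_flip (unit_flip x) = x"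
  and unit_flip_minus: "unit_flip (- x) = - unit_flip x"
  and abs_unit_flip [simp]: "\<bar>unit_flip x\<bar> = \<bar>x\<bar>"
  by (auto simp: unit_flip_def)

lemma unit_flip_comp [simp]: "unit_flip \<circ> (unit_flip \<circ> \<sigma>) = \<sigma>" "(\<sigma> \<circ> unit_flip) \<circ> unit_flip = \<sigma>"
  by (auto simp: fun_eq_iff)

text \<open>Nonzero integers of absolute value other than \<open>1\<close> lie on the same side of
  \<open>1\<close> and of \<open>- 1\<close>.\<close>

lemma unit_flip_less_iff:
  "\<bar>x\<bar> \<noteq> \<bar>y\<bar> \<Longrightarrow> x \<noteq> 0 \<Longrightarrow> y \<noteq> 0 \<Longrightarrow> unit_flip x < unit_flip y \<longleftrightarrow> x < y"
  unfolding unit_flip_def by (cases "\<bar>x\<bar> = 1"; cases "\<bar>y\<bar> = 1") (simp_all, linarith+)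

definition "signed_range n = {- int n..int n} - {0}"

lemma signed_permsD:
  assumes "\<sigma> \<in> signed_perms n"
  shows "\<sigma> permutes signed_range n" "\<sigma> (- x) = - \<sigma> x"
    "x \<in> signed_range n \<Longrightarrow> \<sigma> x \<in> signed_range n"
proof -
  show p: "\<sigma> permutes signed_range n" using assms by (simp add: signed_perms_def signed_range_def)
  \<comment> \<open>Oddness extends to all integers, since \<open>\<sigma>\<close> is the identity
    outside the signed range.\<close>
  show "\<sigma> (- x) = - \<sigma> x"
  proof (cases "x \<in> signed_range n")
    case True
    then show ?thesis using assms by (simp add: signed_perms_def signed_range_def)
  next
    case False
    then have "- x \<notin> signed_range n" by (auto simp: signed_range_def)
    then show ?thesis using False p by (simp add: permutes_not_in)
  qed
  show "x \<in> signed_range n \<Longrightarrow> \<sigma> x \<in> signed_range n" using p by (simp add: permutes_in_image)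
qed

lemma signed_perms_abs_inj:
  assumes "\<sigma> \<in> signed_perms n" "\<bar>\<sigma> x\<bar> = \<bar>\<sigma> y\<bar>" shows "\<bar>x\<bar> = \<bar>y\<bar>"
proof -
  have "\<sigma> x = \<sigma> y \<or> \<sigma> x = \<sigma> (- y)"
    using assms(2) unfolding abs_eq_iff signed_permsD(2)[OF assms(1), of y] .
  then have "x = y \<or> x = - y"
    using permutes_inj[OF signed_permsD(1)[OF assms(1)]] by (metis injD)
  then show ?thesis by auto
qed

lemma finite_signed_perms: "finite (signed_perms n)"
  by (rule finite_subset[OF _ finite_permutations[of "{- int n..int n} - {0}"]])
    (auto simp: signed_perms_def)

lemma unit_flip_permutes: "1 \<le> n \<Longrightarrow> unit_flip permutes signed_range n"
  by (rule bij_imp_permutes, rule bij_betw_byWitness[where f' = unit_flip])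
    (auto simp: unit_flip_def signed_range_def)

lemma signed_perms_unit_flip:
  assumes "1 \<le> n" "\<sigma> \<in> signed_perms n"
  shows "unit_flip \<circ> \<sigma> \<in> signed_perms n" "\<sigma> \<circ> unit_flip \<in> signed_perms n"
  using permutes_compose[OF signed_permsD(1)[OF assms(2)] unit_flip_permutes[OF assms(1)]]
    permutes_compose[OF unit_flip_permutes[OF assms(1)] signed_permsD(1)[OF assms(2)]]
    signed_permsD(2)[OF assms(2)]
  by (simp_all add: signed_perms_def signed_range_def unit_flip_minus)

section \<open>Sums over all signed permutations and their two sign symmetries\<close>

definition ordered :: "nat \<Rightarrow> nat set \<Rightarrow> (int \<Rightarrow> int) set" where
  "ordered n I = {\<sigma> \<in> signed_perms n. \<forall>i\<in>I. entryD \<sigma> i < entryD \<sigma> (i + 1)}"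

definition ordered_sum :: "nat \<Rightarrow> nat set \<Rightarrow> int poly" where
  "ordered_sum n I = (\<Sum>\<sigma>\<in>ordered n I. weight n \<sigma>)"

lemma finite_ordered: "finite (ordered n I)"
  using finite_signed_perms by (simp add: ordered_def)

text \<open>Both events compare \<open>\<sigma> i\<close> with \<open>\<sigma> j\<close> or with
  \<open>- \<sigma> j\<close>, and \<open>unit_flip\<close> respects these comparisons.\<close>

lemma weight_unit_flip_left:
  assumes "\<sigma> \<in> signed_perms n" shows "weight n (unit_flip \<circ> \<sigma>) = weight n \<sigma>"
  unfolding weight_def word_wt_upt
proof (rule prod.cong[OF refl], clarify)
  fix i j assume ij: "(i::nat) \<in> {1..n}" "j \<in> {1..n}" "i < j"
  then have "int i \<in> signed_range n" "int j \<in> signed_range n" by (auto simp: signed_range_def)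
  then have nz: "\<sigma> (int i) \<noteq> 0" "\<sigma> (int j) \<noteq> 0"
    using signed_permsD(3)[OF assms] by (auto simp: signed_range_def)
  have ne: "\<bar>\<sigma> (int i)\<bar> \<noteq> \<bar>\<sigma> (int j)\<bar>" 
    using signed_perms_abs_inj[OF assms, of "int i" "int j"] ij by auto
  have "unit_flip (\<sigma> (int j)) < unit_flip (\<sigma> (int i)) \<longleftrightarrow> \<sigma> (int j) < \<sigma> (int i)"
    using ne nz by (intro unit_flip_less_iff) auto
  moreover have "unit_flip (\<sigma> (int i)) + unit_flip (\<sigma> (int j)) < 0 \<longleftrightarrow> \<sigma> (int i) + \<sigma> (int j) < 0"
    using unit_flip_less_iff[of "\<sigma> (int i)" "- \<sigma> (int j)"] ne nz by (simp add: unit_flip_minus) linarith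
  ultimately show "pair_wt ((unit_flip \<circ> \<sigma>) (int i), odd i) ((unit_flip \<circ> \<sigma>) (int j), odd j) =
      pair_wt (\<sigma> (int i), odd i) (\<sigma> (int j), odd j)"
    by (simp add: pair_wt_def)
qed

text \<open>Negating the first entry exchanges the two events for every pair that contains position
  \<open>1\<close>, and both events carry the same weight.\<close>

lemma weight_unit_flip_right:
  assumes "\<sigma> \<in> signed_perms n" "1 \<le> n" shows "weight n (\<sigma> \<circ> unit_flip) = weight n \<sigma>"
proof -
  let ?f = "\<lambda>p. (\<sigma> (int p), odd p)"
  have "pair_wt (- v, c) b = pair_wt (v, c) b" for v c b
  proof -
    have "fst b < - v \<longleftrightarrow> v + fst b < 0" "- v + fst b < 0 \<longleftrightarrow> fst b < v" by linarith+
    then show ?thesis by (simp add: pair_wt_def)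
  qed
  then have "pair_wt (- v, c) = pair_wt (v, c)" for v c by (intro ext)
  then have flip: "word_wt ((- v, c) # u) = word_wt ((v, c) # u)" for v c u
    by (simp only: word_wt.simps)
  have upt: "[1..<Suc n] = 1 # [2..<Suc n]" using assms(2) by (simp add: upt_rec numeral_2_eq_2)
  have rest: "map (\<lambda>p. ((\<sigma> \<circ> unit_flip) (int p), odd p)) [2..<Suc n] = map ?f [2..<Suc n]"
    by (intro map_cong) (auto simp: unit_flip_def)
  have "(\<sigma> \<circ> unit_flip) (int 1) = - \<sigma> (int 1)"
    using signed_permsD(2)[OF assms(1), of 1] by (simp add: unit_flip_def)
  then show ?thesis unfolding weight_def upt list.map rest by (simp only: flip)
qed

text \<open>The position whose entry is \<^const>\<open>entryD\<close>: by oddness the convention for \<open>0\<close> reads \<open>\<sigma> (- 2)\<close>.\<close>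
definition position :: "nat \<Rightarrow> int" where
  "position i = (if i = 0 then - 2 else int i)"

lemma entryD_eq: "\<sigma> \<in> signed_perms n \<Longrightarrow> entryD \<sigma> i = \<sigma> (position i)"
  using signed_permsD(2)[of \<sigma> n 2] by (simp add: entryD_def position_def)

lemma position_bounds:
  assumes "2 \<le> n" "I \<subseteq> {0..n - 1}" "i \<in> I"
  shows "position i \<in> signed_range n" "position (i + 1) \<in> signed_range n"
    "\<bar>position i\<bar> \<noteq> \<bar>position (i + 1)\<bar>"
  using assms by (auto simp: position_def signed_range_def)

lemma ordered_unit_flip_left:
  assumes "2 \<le> n" "I \<subseteq> {0..n - 1}" "\<sigma> \<in> ordered n I"
  shows "unit_flip \<circ> \<sigma> \<in> ordered n I"
proof -
  have \<sigma>: "\<sigma> \<in> signed_perms n" using assms by (simp add: ordered_def)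
  have \<sigma>': "unit_flip \<circ> \<sigma> \<in> signed_perms n" using signed_perms_unit_flip \<sigma> assms(1) by simp
  have "entryD (unit_flip \<circ> \<sigma>) i < entryD (unit_flip \<circ> \<sigma>) (i + 1)" if i: "i \<in> I" for i
  proof -
    have "\<sigma> (position i) < \<sigma> (position (i + 1))"
      using assms(3) i entryD_eq[OF \<sigma>] by (simp add: ordered_def)
    moreover have "\<bar>\<sigma> (position i)\<bar> \<noteq> \<bar>\<sigma> (position (i + 1))\<bar>"
      using signed_perms_abs_inj[OF \<sigma>] position_bounds(3)[OF assms(1,2) i] by blast
    moreover have "\<sigma> (position i) \<noteq> 0" "\<sigma> (position (i + 1)) \<noteq> 0"
      using signed_permsD(3)[OF \<sigma>] position_bounds[OF assms(1,2) i] by (force simp: signed_range_def)+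
    ultimately have "unit_flip (\<sigma> (position i)) < unit_flip (\<sigma> (position (i + 1)))"
      using unit_flip_less_iff by blast
    then show ?thesis by (simp only: entryD_eq[OF \<sigma>'] comp_apply)
  qed
  then show ?thesis using \<sigma>' by (simp add: ordered_def)
qed

lemma parity_unit_flip_left:
  assumes "1 \<le> n" "\<sigma> \<in> signed_perms n"
  shows "even (card {i \<in> {1..n}. (unit_flip \<circ> \<sigma>) (int i) < 0}) \<longleftrightarrow>
    odd (card {i \<in> {1..n}. \<sigma> (int i) < 0})" (is "even (card ?N') \<longleftrightarrow> odd (card ?N)")
proof -
  have "1 \<in> signed_range n" using assms(1) by (simp add: signed_range_def)
  then have "1 \<in> \<sigma> ` signed_range n" using permutes_image[OF signed_permsD(1)[OF assms(2)]] by simp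
  then obtain x where x: "x \<in> signed_range n" "\<sigma> x = 1" by auto
  \<comment> \<open>The position of the entry \<open>1\<close> or \<open>- 1\<close>, the only one
    whose sign changes.\<close>
  define k where "k = nat \<bar>x\<bar>"
  have k: "k \<in> {1..n}" using x(1) by (auto simp: k_def signed_range_def)
  have abs_k: "\<bar>\<sigma> (int k)\<bar> = 1"
    using x(2) signed_permsD(2)[OF assms(2), of x] by (auto simp: k_def abs_if)
  have other: "\<bar>\<sigma> (int i)\<bar> \<noteq> 1" if "i \<noteq> k" for i
    using signed_perms_abs_inj[OF assms(2), of "int i" "int k"] abs_k that by auto
  have flip: "unit_flip (\<sigma> (int i)) < 0 \<longleftrightarrow> (if i = k then \<not> \<sigma> (int i) < 0 else \<sigma> (int i) < 0)" for i
    using other[of i] abs_k by (auto simp: unit_flip_def)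
  show ?thesis
  proof (cases "k \<in> ?N")
    case True
    then have "?N = insert k ?N'" "k \<notin> ?N'" using flip by auto
    then show ?thesis by simp
  next
    case False
    then have "?N' = insert k ?N" using flip k by auto
    then show ?thesis using False by simp
  qed
qed

text \<open>Left composition with \<open>unit_flip\<close> preserves ascents and weight but reverses
  the parity of the number of negative entries. The even half of \<open>ordered n I\<close>
  therefore carries half of its sum.\<close>

lemma quotientD_poly_eq:
  assumes "2 \<le> n" "I \<subseteq> {0..n - 1}"
  shows "2 * quotientD_poly n I = ordered_sum n I"
proof -
  let ?f = "\<lambda>\<sigma>. unit_flip \<circ> \<sigma>" and ?Q = "quotientD n I"
  have Q: "?Q = {\<sigma> \<in> ordered n I. even (card {i \<in> {1..n}. \<sigma> (int i) < 0})}"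
    by (auto simp: quotientD_def ordered_def even_signed_perms_def)
  have perm: "\<sigma> \<in> signed_perms n" if "\<sigma> \<in> ordered n I" for \<sigma> using that by (simp add: ordered_def)
  have parity: "even (card {i \<in> {1..n}. ?f \<sigma> (int i) < 0}) \<longleftrightarrow> odd (card {i \<in> {1..n}. \<sigma> (int i) < 0})"
    if "\<sigma> \<in> ordered n I" for \<sigma>
    using parity_unit_flip_left[OF _ perm[OF that]] assms(1) by linarith
  have flip: "?f \<sigma> \<in> ordered n I" if "\<sigma> \<in> ordered n I" for \<sigma>
    using ordered_unit_flip_left[OF assms that] .
  have "ordered n I = ?Q \<union> ?f ` ?Q"
  proof (intro equalityI subsetI)
    fix \<sigma> assume \<sigma>: "\<sigma> \<in> ordered n I"
    show "\<sigma> \<in> ?Q \<union> ?f ` ?Q"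
    proof (cases "\<sigma> \<in> ?Q")
      case False
      then have "?f \<sigma> \<in> ?Q" using \<sigma> parity[OF \<sigma>] flip[OF \<sigma>] unfolding Q by blast
      then have "?f (?f \<sigma>) \<in> ?f ` ?Q" by (rule imageI)
      then show ?thesis by simp
    qed simp
  next
    fix \<sigma> assume "\<sigma> \<in> ?Q \<union> ?f ` ?Q"
    then show "\<sigma> \<in> ordered n I" using flip unfolding Q by blast
  qed
  moreover have "?Q \<inter> ?f ` ?Q = {}" using parity unfolding Q by blast
  moreover have "finite ?Q" using finite_ordered by (simp add: Q)
  moreover have "inj_on ?f ?Q" by (rule inj_on_inverseI[where g = ?f]) simp
  ultimately have "ordered_sum n I = (\<Sum>\<sigma>\<in>?Q. weight n \<sigma>) + (\<Sum>\<sigma>\<in>?Q. weight n (?f \<sigma>))"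
    by (simp add: ordered_sum_def sum.union_disjoint sum.reindex comp_def[of "weight n"])
  also have "(\<Sum>\<sigma>\<in>?Q. weight n (?f \<sigma>)) = (\<Sum>\<sigma>\<in>?Q. weight n \<sigma>)"
    using weight_unit_flip_left perm unfolding Q by (intro sum.cong) auto
  finally show ?thesis by (simp add: quotientD_poly_def weight_eq)
qed

text \<open>Negating the first entry turns \<open>- \<sigma> 2 < \<sigma> 1\<close> into
  \<open>\<sigma> 1 < \<sigma> 2\<close> and vice versa. This is the symmetry of the Dynkin diagram
  of type D that exchanges its nodes \<open>0\<close> and \<open>1\<close>.\<close>

lemma ordered_unit_flip_right:
  assumes "2 \<le> n" "\<sigma> \<in> ordered n I"
  shows "\<sigma> \<circ> unit_flip \<in> ordered n (transpose 0 1 ` I)"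
proof -
  have \<sigma>: "\<sigma> \<in> signed_perms n" using assms by (simp add: ordered_def)
  have \<sigma>': "\<sigma> \<circ> unit_flip \<in> signed_perms n" using signed_perms_unit_flip \<sigma> assms(1) by simp
  have "entryD (\<sigma> \<circ> unit_flip) (transpose 0 1 i) < entryD (\<sigma> \<circ> unit_flip) (transpose 0 1 i + 1)"
    if i: "i \<in> I" for i
  proof -
    have *: "\<sigma> (position i) < \<sigma> (position (i + 1))"
      using assms(2) i entryD_eq[OF \<sigma>] by (simp add: ordered_def)
    consider "i = 0" | "i = 1" | "1 < i" by linarith
    then show ?thesis
    proof cases
      case 1
      then show ?thesis
        using * signed_permsD(2)[OF \<sigma>, of 1] signed_permsD(2)[OF \<sigma>, of 2]
        unfolding entryD_eq[OF \<sigma>'] by (simp add: position_def unit_flip_def)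
    next
      case 2
      then show ?thesis
        using * signed_permsD(2)[OF \<sigma>, of 1] signed_permsD(2)[OF \<sigma>, of 2]
        unfolding entryD_eq[OF \<sigma>'] by (simp add: position_def unit_flip_def)
    next
      case 3
      then show ?thesis
        using * unfolding entryD_eq[OF \<sigma>'] by (simp add: position_def unit_flip_def)
    qed
  qed
  then show ?thesis using \<sigma>' by (simp add: ordered_def)
qed

lemma ordered_sum_transpose:
  assumes "2 \<le> n"
  shows "ordered_sum n (transpose 0 1 ` I) = ordered_sum n I"
  unfolding ordered_sum_def
proof (rule sum.reindex_bij_witness[where i = "\<lambda>\<sigma>. \<sigma> \<circ> unit_flip" and j = "\<lambda>\<sigma>. \<sigma> \<circ> unit_flip"])
  have "transpose 0 1 ` transpose 0 1 ` I = I" by (simp add: image_image)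
  then show "\<sigma> \<circ> unit_flip \<in> ordered n I" if "\<sigma> \<in> ordered n (transpose 0 1 ` I)" for \<sigma>
    using ordered_unit_flip_right[OF assms that] by simp
  show "\<sigma> \<circ> unit_flip \<in> ordered n (transpose 0 1 ` I)" if "\<sigma> \<in> ordered n I" for \<sigma>
    using ordered_unit_flip_right[OF assms that] .
  show "weight n (\<sigma> \<circ> unit_flip) = weight n \<sigma>" if "\<sigma> \<in> ordered n (transpose 0 1 ` I)" for \<sigma>
    using weight_unit_flip_right[of \<sigma> n] that assms by (simp add: ordered_def)
qed simp_all

text \<open>Here \<open>I\<close> is invariant under exchanging \<open>0\<close> and
  \<open>1\<close>, so negating the first entry pairs positive with negative first entries. This is
  the source of the positivity flag on the leading block.\<close>

lemma ordered_sum_positive: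
  assumes "2 \<le> n" "{0, 1} \<subseteq> I"
  shows "ordered_sum n I = 2 * (\<Sum>\<sigma> | \<sigma> \<in> ordered n I \<and> 0 < \<sigma> 1. weight n \<sigma>)"
proof -
  let ?P = "{\<sigma> \<in> ordered n I. 0 < \<sigma> 1}" and ?N = "{\<sigma> \<in> ordered n I. \<sigma> 1 < 0}"
  have I: "transpose 0 1 ` I = I"
    using assms(2) by (intro transpose_image_eq) auto
  have flip: "\<sigma> \<circ> unit_flip \<in> ordered n I" "(\<sigma> \<circ> unit_flip) 1 = - \<sigma> 1"
    if "\<sigma> \<in> ordered n I" for \<sigma>
  proof -
    show "\<sigma> \<circ> unit_flip \<in> ordered n I"
      using ordered_unit_flip_right[OF assms(1) that] unfolding I .
    show "(\<sigma> \<circ> unit_flip) 1 = - \<sigma> 1"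
      using signed_permsD(2)[of \<sigma> n 1] that by (simp add: ordered_def unit_flip_def)
  qed
  have "\<sigma> 1 \<noteq> 0" if "\<sigma> \<in> ordered n I" for \<sigma>
    using signed_permsD(3)[of \<sigma> n 1] that assms(1) by (auto simp: ordered_def signed_range_def)
  then have "ordered n I = ?P \<union> ?N" by force
  then have "ordered_sum n I = (\<Sum>\<sigma>\<in>?P. weight n \<sigma>) + (\<Sum>\<sigma>\<in>?N. weight n \<sigma>)"
    unfolding ordered_sum_def using finite_ordered
    by (subst sum.union_disjoint[symmetric]) auto
  also have "(\<Sum>\<sigma>\<in>?N. weight n \<sigma>) = (\<Sum>\<sigma>\<in>?P. weight n \<sigma>)"
  proof (rule sum.reindex_bij_witness[where i = "\<lambda>\<sigma>. \<sigma> \<circ> unit_flip" and j = "\<lambda>\<sigma>. \<sigma> \<circ> unit_flip"])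
    show "weight n (\<sigma> \<circ> unit_flip) = weight n \<sigma>" if "\<sigma> \<in> ?N" for \<sigma>
      using weight_unit_flip_right[of \<sigma> n] that assms by (simp add: ordered_def)
    show "\<sigma> \<circ> unit_flip \<in> ?P" if "\<sigma> \<in> ?N" for \<sigma> using flip[of \<sigma>] that by simp
    show "\<sigma> \<circ> unit_flip \<in> ?N" if "\<sigma> \<in> ?P" for \<sigma> using flip[of \<sigma>] that by simp
  qed simp_all
  finally show ?thesis by simp
qed

section \<open>From signed permutations to shapes\<close>

fun runs :: "nat \<Rightarrow> nat list \<Rightarrow> nat list list" where
  "runs s [] = []"
| "runs s (b # bs) = [Suc s..<Suc s + b] # runs (s + b) bs"

lemma concat_runs: "concat (runs s bs) = [Suc s..<Suc s + sum_list bs]"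
proof (induction bs arbitrary: s)
  case (Cons b bs)
  then show ?case using upt_add_eq_append[of "Suc s" "Suc s + b" "sum_list bs"] by (simp add: add.assoc)
qed simp

lemma map_odd_upt: "map odd [Suc s..<Suc s + b] = alt (even s) b"
proof (induction b)
  case (Suc b)
  have "[Suc s..<Suc s + Suc b] = [Suc s..<Suc s + b] @ [Suc s + b]" by simp
  then show ?case using Suc by (auto simp: alt_Suc_snoc)
qed simp

lemma blocks_eq_runs: "blocks (even s) bs = map (\<lambda>Y. (False, map odd Y)) (runs s bs)"
proof (induction bs arbitrary: s)
  case (Cons b bs)
  have "(even s \<noteq> odd b) = even (s + b)" by auto
  then show ?case using Cons[of "s + b"] map_odd_upt[of s b] by (simp del: upt_Suc)
qed simp

definition reading :: "nat list list \<Rightarrow> (int \<Rightarrow> int) \<Rightarrow> (int \<times> bool) list list" where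
  "reading Ps \<sigma> = map (map (\<lambda>p. (\<sigma> (int p), odd p))) Ps"

lemma concat_reading: "concat (reading Ps \<sigma>) = map (\<lambda>p. (\<sigma> (int p), odd p)) (concat Ps)"
  by (simp add: reading_def map_concat)

text \<open>The odd function with values \<open>v\<close> at \<open>1\<close>, ...,
  \<open>length v\<close>; list indices are shifted by one against positions.\<close>

definition signed_extension :: "int list \<Rightarrow> int \<Rightarrow> int" where
  "signed_extension v x =
     (if x \<in> signed_range (length v) then sgn x * v ! (nat \<bar>x\<bar> - 1) else x)"

lemma in_signed_range_iff: "x \<in> signed_range n \<longleftrightarrow> 1 \<le> \<bar>x\<bar> \<and> \<bar>x\<bar> \<le> int n"
  by (auto simp: signed_range_def)

lemma signed_extension_in_signed_perms:
  assumes "mset (map abs v) = mset [1..int (length v)]"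
  shows "signed_extension v \<in> signed_perms (length v)"
proof -
  let ?S = "signed_range (length v)" and ?\<sigma> = "signed_extension v"
  have dist: "distinct (map abs v)" using assms by (metis distinct_upto mset_eq_imp_distinct_iff)
  have "set (map abs v) = {1..int (length v)}"
    using arg_cong[OF assms, of set_mset] by simp
  then have range: "\<bar>v ! i\<bar> \<in> {1..int (length v)}" if "i < length v" for i
    using that nth_mem[of i "map abs v"] by simp
  have ix: "nat \<bar>x\<bar> - 1 < length v" if "x \<in> ?S" for x using that by (auto simp: signed_range_def)
  have abs_\<sigma>: "\<bar>?\<sigma> x\<bar> = \<bar>v ! (nat \<bar>x\<bar> - 1)\<bar>" if "x \<in> ?S" for x
    using that by (auto simp: signed_extension_def abs_mult signed_range_def sgn_if)
  have into: "?\<sigma> x \<in> ?S" if "x \<in> ?S" for x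
    using abs_\<sigma>[OF that] range[OF ix[OF that]] unfolding in_signed_range_iff by simp
  have "inj_on ?\<sigma> ?S"
  proof (rule inj_onI)
    fix x y assume xy: "x \<in> ?S" "y \<in> ?S" "?\<sigma> x = ?\<sigma> y"
    have "\<bar>v ! (nat \<bar>x\<bar> - 1)\<bar> = \<bar>v ! (nat \<bar>y\<bar> - 1)\<bar>"
      using abs_\<sigma>[OF xy(1)] abs_\<sigma>[OF xy(2)] xy(3) by argo
    then have "map abs v ! (nat \<bar>x\<bar> - 1) = map abs v ! (nat \<bar>y\<bar> - 1)"
      using ix[OF xy(1)] ix[OF xy(2)] by simp
    then have ixy: "nat \<bar>x\<bar> - 1 = nat \<bar>y\<bar> - 1"
      using nth_eq_iff_index_eq[OF dist, of "nat \<bar>x\<bar> - 1" "nat \<bar>y\<bar> - 1"] ix[OF xy(1)] ix[OF xy(2)]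
      unfolding length_map by blast
    moreover have "v ! (nat \<bar>x\<bar> - 1) \<noteq> 0" using range[OF ix[OF xy(1)]] by auto
    ultimately have "sgn x = sgn y" using xy by (simp add: signed_extension_def)
    moreover have "\<bar>x\<bar> = \<bar>y\<bar>" using ixy xy(1,2) by (auto simp: signed_range_def)
    ultimately show "x = y" by (metis sgn_mult_abs)
  qed
  moreover have "?\<sigma> ` ?S = ?S"
    using into \<open>inj_on ?\<sigma> ?S\<close> by (intro endo_inj_surj) (auto simp: signed_range_def)
  ultimately have "?\<sigma> permutes ?S"
    by (intro bij_imp_permutes) (auto simp: bij_betw_def signed_extension_def)
  moreover have "\<forall>x\<in>?S. ?\<sigma> (- x) = - ?\<sigma> x"
    by (auto simp: signed_extension_def signed_range_def)
  ultimately show ?thesis by (simp add: signed_perms_def signed_range_def)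
qed

lemma mset_abs_signed_perm:
  assumes "\<sigma> \<in> signed_perms n"
  shows "mset (map (\<lambda>p. \<bar>\<sigma> (int p)\<bar>) [1..<Suc n]) = mset [1..int n]"
proof -
  let ?v = "map (\<lambda>p. \<bar>\<sigma> (int p)\<bar>) [1..<Suc n]"
  have "inj_on (\<lambda>p. \<bar>\<sigma> (int p)\<bar>) (set [1..<Suc n])"
  proof (rule inj_onI)
    fix p q assume "\<bar>\<sigma> (int p)\<bar> = \<bar>\<sigma> (int q)\<bar>"
    then show "p = q" using signed_perms_abs_inj[OF assms, of "int p" "int q"] by simp
  qed
  then have d: "distinct ?v" by (simp add: distinct_map del: upt_Suc)
  have "set ?v \<subseteq> {1..int n}"
  proof
    fix y assume "y \<in> set ?v"
    then obtain p where p: "y = \<bar>\<sigma> (int p)\<bar>" "1 \<le> p" "p \<le> n" by auto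
    then have "int p \<in> signed_range n" by (simp add: signed_range_def)
    then have "\<sigma> (int p) \<in> signed_range n" using signed_permsD(3)[OF assms] by blast
    then show "y \<in> {1..int n}" using p(1) by (auto simp: signed_range_def)
  qed
  moreover have "card (set ?v) = card {1..int n}"
    using distinct_card[OF d] by simp
  ultimately have "set ?v = set [1..int n]" by (simp add: card_subset_eq)
  then show ?thesis using d by (metis distinct_upto set_eq_iff_mset_eq_distinct)
qed

lemma concat_eq_imp_eq: "concat xs = concat ys \<Longrightarrow> map length xs = map length ys \<Longrightarrow> xs = ys"
proof (induction xs arbitrary: ys)
  case (Cons x xs)
  then show ?case by (cases ys) auto
qed simp

text \<open>By oddness a signed permutation is determined by its values at \<open>1\<close>, ...,
  \<open>n\<close>. Conversely, the entries of a filling extend to one by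
  \<open>signed_extension\<close>.\<close>

lemma bij_betw_reading:
  assumes cols: "map snd Bs = map (map odd) Ps" and Ps: "concat Ps = [1..<Suc n]"
  shows "bij_betw (reading Ps) {\<sigma> \<in> signed_perms n. list_all2 fills Bs (reading Ps \<sigma>)} (fillings Bs)"
    (is "bij_betw _ ?A _")
proof -
  have cB: "cols Bs = map odd [1..<Suc n]"
    unfolding cols_def cols Ps[symmetric] by (simp add: map_concat)
  have inj: "inj_on (reading Ps) ?A"
  proof (rule inj_onI)
    fix \<sigma> \<tau> assume st: "\<sigma> \<in> ?A" "\<tau> \<in> ?A" "reading Ps \<sigma> = reading Ps \<tau>"
    from st(3) have "concat (reading Ps \<sigma>) = concat (reading Ps \<tau>)" by simp
    then have pos: "\<sigma> (int p) = \<tau> (int p)" if "p \<in> {1..n}" for p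
      using that unfolding concat_reading Ps by (auto simp del: upt_Suc)
    show "\<sigma> = \<tau>"
    proof
      fix x
      have \<sigma>: "\<sigma> \<in> signed_perms n" and \<tau>: "\<tau> \<in> signed_perms n" using st by auto
      consider "x \<notin> signed_range n" | "x \<in> {1..int n}" | "- x \<in> {1..int n}"
        by (fastforce simp: signed_range_def)
      then show "\<sigma> x = \<tau> x"
      proof cases
        case 1
        then show ?thesis
          using signed_permsD(1)[OF \<sigma>] signed_permsD(1)[OF \<tau>] by (simp add: permutes_not_in)
      next
        case 2
        then have "nat x \<in> {1..n}" "int (nat x) = x" by auto
        then show ?thesis using pos[of "nat x"] by metis
      next
        case 3
        then have "nat (- x) \<in> {1..n}" "int (nat (- x)) = - x" by auto
        then have "\<sigma> (- x) = \<tau> (- x)" using pos[of "nat (- x)"] by metis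
        then show ?thesis using signed_permsD(2)[OF \<sigma>, of x] signed_permsD(2)[OF \<tau>, of x] by simp
      qed
    qed
  qed
  have "reading Ps ` ?A = fillings Bs"
  proof (intro equalityI subsetI)
    fix ws assume "ws \<in> reading Ps ` ?A"
    then obtain \<sigma> where \<sigma>: "\<sigma> \<in> signed_perms n" "list_all2 fills Bs ws" "ws = reading Ps \<sigma>" by auto
    have "abs_vals (concat ws) = mset [1..int n]"
      unfolding \<sigma>(3) concat_reading Ps abs_vals_def
      using mset_abs_signed_perm[OF \<sigma>(1)] by (simp add: comp_def del: upt_Suc)
    then show "ws \<in> fillings Bs" using \<sigma> by (simp add: fillings_def cB)
  next
    fix ws assume ws: "ws \<in> fillings Bs"
    define v where "v = map fst (concat ws)"
    have l2: "list_all2 fills Bs ws" using ws by (simp add: fillings_def)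
    have snd: "map snd (concat ws) = map odd [1..<Suc n]" using map_snd_concat_fills[OF l2] cB by simp
    have lc: "length (concat ws) = n" using arg_cong[OF snd, of length] by (simp del: length_concat)
    then have lv: "length v = n" by (simp add: v_def del: length_concat)
    have "mset (map abs v) = mset [1..int (length v)]"
      using ws unfolding lv by (simp add: fillings_def abs_vals_def cB v_def comp_def)
    then have \<sigma>: "signed_extension v \<in> signed_perms n" using signed_extension_in_signed_perms lv by blast
    have "concat (reading Ps (signed_extension v)) = concat ws"
    proof (rule nth_equalityI)
      show len: "length (concat (reading Ps (signed_extension v))) = length (concat ws)"
        unfolding concat_reading Ps lc by simp
      fix i assume "i < length (concat (reading Ps (signed_extension v)))"
      then have i: "i < n" using len lc by simp
      have "snd (concat ws ! i) = odd (Suc i)"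
        using arg_cong[OF snd, of "\<lambda>l. l ! i"] i lc by (simp del: upt_Suc length_concat)
      moreover have "fst (concat ws ! i) = v ! i" using i lc by (simp add: v_def del: length_concat)
      moreover have "signed_extension v (int (Suc i)) = v ! i"
        using i lv by (simp add: signed_extension_def signed_range_def del: of_nat_Suc)
      ultimately show "concat (reading Ps (signed_extension v)) ! i = concat ws ! i"
        unfolding concat_reading Ps using i by (simp add: prod_eq_iff del: upt_Suc)
    qed
    \<comment> \<open>The concatenations agree; equal block lengths then make the lists of blocks
      agree.\<close>
    moreover have "map length (reading Ps (signed_extension v)) = map length ws"
    proof -
      have "map (map snd) ws = map snd Bs"
        using l2 by (induction rule: list_all2_induct) (auto simp: fills_def)
      then have "map length (map (map snd) ws) = map length (map (map odd) Ps)"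
        unfolding cols by (rule arg_cong)
      then have "map length ws = map length Ps" by (simp add: comp_def)
      then show ?thesis by (simp add: reading_def comp_def)
    qed
    ultimately have ws_eq: "reading Ps (signed_extension v) = ws"
      by (rule concat_eq_imp_eq)
    show "ws \<in> reading Ps ` ?A"
      by (rule image_eqI[of _ _ "signed_extension v"]) (simp_all add: ws_eq \<sigma> l2)
  qed
  with inj show ?thesis by (simp add: bij_betw_def)
qed

lemma gf_eq_sum_weight:
  assumes "map snd Bs = map (map odd) Ps" and "concat Ps = [1..<Suc n]"
  shows "gf Bs = (\<Sum>\<sigma> | \<sigma> \<in> signed_perms n \<and> list_all2 fills Bs (reading Ps \<sigma>). weight n \<sigma>)"
  unfolding gf_def using sum.reindex_bij_betw[OF bij_betw_reading[OF assms], of "\<lambda>ws. word_wt (concat ws)"]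
  by (simp add: concat_reading assms(2) weight_def)

section \<open>Block lengths and ascent conditions\<close>

text \<open>
  The positions from \<open>s + 1\<close> on are divided into blocks of lengths \<open>bs\<close>, which are the maximal
  ones with ascents prescribed by \<open>I\<close>. A block of length \<open>b\<close> stems from a component of size \<open>b - 1\<close>.
\<close>
fun run_lengths :: "nat set \<Rightarrow> nat \<Rightarrow> nat list \<Rightarrow> bool" where
  "run_lengths I s [] \<longleftrightarrow> True"
| "run_lengths I s (b # bs) \<longleftrightarrow> {Suc s..<s + b} \<subseteq> I \<and> s + b \<notin> I \<and> run_lengths I (s + b) bs"

lemma run_lengths_cong:
  assumes "\<And>i. s < i \<Longrightarrow> i \<in> I \<longleftrightarrow> i \<in> J" and "\<forall>b\<in>set bs. 0 < b"
  shows "run_lengths I s bs \<longleftrightarrow> run_lengths J s bs"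
  using assms
proof (induction bs arbitrary: s)
  case (Cons b bs)
  then have "0 < b" by simp
  have "run_lengths I (s + b) bs \<longleftrightarrow> run_lengths J (s + b) bs"
    using Cons.prems by (intro Cons.IH) auto
  moreover have "{Suc s..<s + b} \<subseteq> I \<longleftrightarrow> {Suc s..<s + b} \<subseteq> J"
    using Cons.prems(1) by (metis (no_types, lifting) Suc_le_lessD atLeastLessThan_iff subset_iff)
  ultimately show ?case using Cons.prems(1)[of "s + b"] \<open>0 < b\<close> by simp
qed simp

lemma run_lengths_exist:
  assumes "\<forall>i\<in>I. i < n" "s \<le> n"
  shows "\<exists>bs. (\<forall>b\<in>set bs. 0 < b) \<and> s + sum_list bs = n \<and> run_lengths I s bs"
  using assms(2)
proof (induction "n - s" arbitrary: s rule: less_induct)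
  case less
  show ?case
  proof (cases "s = n")
    case True
    then show ?thesis by (intro exI[of _ "[]"]) simp
  next
    case False
    \<comment> \<open>The block ends at the first position after \<open>s\<close> without a
      prescribed ascent. The choice \<open>b = n - s\<close> qualifies because \<open>n\<close> is
      not in \<open>I\<close>, so the block stays within the first \<open>n\<close>
      positions.\<close>
    define b where "b = (LEAST b. 0 < b \<and> s + b \<notin> I)"
    have n: "0 < n - s \<and> s + (n - s) \<notin> I" using False less.prems assms(1) by auto
    have b: "0 < b \<and> s + b \<notin> I" unfolding b_def
      by (rule LeastI[of "\<lambda>b. 0 < b \<and> s + b \<notin> I", OF n])
    have "b \<le> n - s" unfolding b_def
      by (rule Least_le[of "\<lambda>b. 0 < b \<and> s + b \<notin> I", OF n])
    then have sb: "s + b \<le> n" "n - (s + b) < n - s" using b less.prems False by linarith+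
    then obtain bs where bs: "\<forall>b\<in>set bs. 0 < b" "s + b + sum_list bs = n" "run_lengths I (s + b) bs"
      using less.hyps[OF sb(2,1)] by blast
    have "{Suc s..<s + b} \<subseteq> I"
    proof
      fix i assume i: "i \<in> {Suc s..<s + b}"
      then have "i - s < b" by auto
      then have "\<not> (0 < i - s \<and> s + (i - s) \<notin> I)" unfolding b_def by (rule not_less_Least)
      then show "i \<in> I" using i by simp
    qed
    then show ?thesis using bs b by (intro exI[of _ "b # bs"]) simp
  qed
qed

lemma sorted_wrt_upt:
  "sorted_wrt (<) (map (\<lambda>p. \<sigma> (int p)) [Suc s..<Suc s + b]) \<longleftrightarrow>
     (\<forall>i\<in>{Suc s..<s + b}. \<sigma> (int i) < (\<sigma> (int i + 1) :: int))" (is "?L \<longleftrightarrow> ?R")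
proof -
  have "?L \<longleftrightarrow> (\<forall>i. Suc i < b \<longrightarrow> \<sigma> (int (Suc s + i)) < \<sigma> (int (Suc s + i) + 1))"
    by (subst sorted_wrt_iff_nth_Suc_transp) (auto simp: algebra_simps simp del: upt_Suc)
  also have "\<dots> \<longleftrightarrow> ?R"
  proof safe
    fix i assume *: "\<forall>i. Suc i < b \<longrightarrow> \<sigma> (int (Suc s + i)) < \<sigma> (int (Suc s + i) + 1)"
      and i: "i \<in> {Suc s..<s + b}"
    from i have "Suc (i - Suc s) < b" "Suc s + (i - Suc s) = i" by auto
    with * show "\<sigma> (int i) < \<sigma> (int i + 1)" by metis
  next
    fix i assume *: "?R" and i: "Suc i < b"
    have "Suc s + i \<in> {Suc s..<s + b}" using i by simp
    with * show "\<sigma> (int (Suc s + i)) < \<sigma> (int (Suc s + i) + 1)" by blast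
  qed
  finally show ?thesis .
qed

lemma fills_reading:
  "fills (p, map odd Y) (map (\<lambda>p. (\<sigma> (int p), odd p)) Y) \<longleftrightarrow>
     sorted_wrt (<) (map (\<lambda>p. \<sigma> (int p)) Y) \<and> (p \<longrightarrow> (\<forall>p\<in>set Y. 0 < \<sigma> (int p)))"
  by (simp add: fills_def comp_def)

lemma fills_runs:
  assumes "run_lengths I s bs" and "\<forall>b\<in>set bs. 0 < b"
  shows "list_all2 fills (blocks (even s) bs) (reading (runs s bs) \<sigma>) \<longleftrightarrow>
     (\<forall>i\<in>I. s < i \<and> i < s + sum_list bs \<longrightarrow> \<sigma> (int i) < \<sigma> (int i + 1))"
  using assms
proof (induction bs arbitrary: s)
  case (Cons b bs)
  let ?P = "\<lambda>i. \<sigma> (int i) < \<sigma> (int i + 1)"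
  have IH: "list_all2 fills (blocks (even (s + b)) bs) (reading (runs (s + b) bs) \<sigma>) \<longleftrightarrow>
     (\<forall>i\<in>I. s + b < i \<and> i < s + b + sum_list bs \<longrightarrow> ?P i)"
    by (rule Cons.IH) (use Cons.prems in auto)
  have blk: "blocks (even s) (b # bs) = B (even s) b # blocks (even (s + b)) bs" by simp
  have read: "reading (runs s (b # bs)) \<sigma> =
      map (\<lambda>p. (\<sigma> (int p), odd p)) [Suc s..<Suc s + b] # reading (runs (s + b) bs) \<sigma>"
    by (simp add: reading_def del: upt_Suc)
  have "list_all2 fills (blocks (even s) (b # bs)) (reading (runs s (b # bs)) \<sigma>) \<longleftrightarrow>
      (\<forall>i\<in>{Suc s..<s + b}. ?P i) \<and>
      (\<forall>i\<in>I. s + b < i \<and> i < s + b + sum_list bs \<longrightarrow> ?P i)"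
    unfolding blk read list_all2_Cons IH map_odd_upt[symmetric] fills_reading sorted_wrt_upt by simp
  also have "\<dots> \<longleftrightarrow> (\<forall>i\<in>I. s < i \<and> i < s + sum_list (b # bs) \<longrightarrow> ?P i)"
  proof safe
    fix i
    assume *: "\<forall>i\<in>{Suc s..<s + b}. ?P i"
      and **: "\<forall>i\<in>I. s + b < i \<and> i < s + b + sum_list bs \<longrightarrow> ?P i"
      and i: "i \<in> I" "s < i" "i < s + sum_list (b # bs)"
    have "i \<noteq> s + b" using i Cons.prems(1) by auto
    then consider "i < s + b" | "s + b < i" by linarith
    then show "?P i" using * ** i by cases auto
  next
    fix i assume *: "\<forall>i\<in>I. s < i \<and> i < s + sum_list (b # bs) \<longrightarrow> ?P i" and i: "i \<in> {Suc s..<s + b}"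
    then have "i \<in> I" using Cons.prems(1) by auto
    then show "?P i" using * i by auto
  next
    fix i assume *: "\<forall>i\<in>I. s < i \<and> i < s + sum_list (b # bs) \<longrightarrow> ?P i"
      and i: "i \<in> I" "s + b < i" "i < s + b + sum_list bs"
    then show "?P i" by auto
  qed
  finally show ?case .
qed (simp add: reading_def)

text \<open>On the leading block, which occupies the positions \<open>1\<close>, ...,
  \<open>a\<close>, the ascents reduce positivity of all entries to positivity of
  \<open>\<sigma> 1\<close>. For \<open>a = 0\<close> that block is empty and imposes
  nothing.\<close>

lemma gf_eq_sum_ascents:
  assumes "{1..<a} \<subseteq> I" and "a = 0 \<or> a \<notin> I" and I: "\<forall>i\<in>I. i < n"
    and "run_lengths I a bs" and "\<forall>b\<in>set bs. 0 < b" and n: "a + sum_list bs = n"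
  shows "gf (D True a # blocks (even a) bs) = (\<Sum>\<sigma> | \<sigma> \<in> signed_perms n \<and> (0 < a \<longrightarrow> 0 < \<sigma> 1) \<and>
    (\<forall>i\<in>I. 0 < i \<longrightarrow> \<sigma> (int i) < \<sigma> (int i + 1)). weight n \<sigma>)"
proof -
  let ?Ps = "[Suc 0..<Suc 0 + a] # runs a bs" and ?Bs = "D True a # blocks (even a) bs"
  let ?P = "\<lambda>\<sigma> i. \<sigma> (int i) < (\<sigma> (int i + 1) :: int)"
  have first: "alt True a = map odd [Suc 0..<Suc 0 + a]" using map_odd_upt[of 0 a] by simp
  have conds: "list_all2 fills ?Bs (reading ?Ps \<sigma>) \<longleftrightarrow>
      (0 < a \<longrightarrow> 0 < \<sigma> 1) \<and> (\<forall>i\<in>I. 0 < i \<longrightarrow> ?P \<sigma> i)" for \<sigma>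
  proof -
    have "list_all2 fills ?Bs (reading ?Ps \<sigma>) \<longleftrightarrow>
        ((\<forall>i\<in>{1..<a}. ?P \<sigma> i) \<and> (\<forall>p\<in>{1..a}. 0 < \<sigma> (int p))) \<and>
        (\<forall>i\<in>I. a < i \<and> i < n \<longrightarrow> ?P \<sigma> i)"
      using fills_reading[of True "[Suc 0..<Suc 0 + a]" \<sigma>] fills_runs[OF assms(4,5), of \<sigma>]
        sorted_wrt_upt[of \<sigma> 0 a] n first
      by (simp add: reading_def atLeastLessThanSuc_atLeastAtMost del: upt_Suc)
    moreover have "(\<forall>p\<in>{1..a}. 0 < \<sigma> (int p)) \<longleftrightarrow> (0 < a \<longrightarrow> 0 < \<sigma> 1)"
      if asc: "\<forall>i\<in>{1..<a}. ?P \<sigma> i"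
    proof
      assume "\<forall>p\<in>{1..a}. 0 < \<sigma> (int p)"
      then show "0 < a \<longrightarrow> 0 < \<sigma> 1" by (auto dest: bspec[of _ _ 1])
    next
      assume *: "0 < a \<longrightarrow> 0 < \<sigma> 1"
      have "1 \<le> p \<Longrightarrow> p \<le> a \<Longrightarrow> 0 < \<sigma> (int p)" for p
      proof (induction p rule: dec_induct)
        case base
        then show ?case using * by simp
      next
        case (step p)
        then have "?P \<sigma> p" using asc by simp
        then show ?case using step by (simp add: add.commute)
      qed
      then show "\<forall>p\<in>{1..a}. 0 < \<sigma> (int p)" by simp
    qed
    moreover have "(\<forall>i\<in>{1..<a}. ?P \<sigma> i) \<and> (\<forall>i\<in>I. a < i \<and> i < n \<longrightarrow> ?P \<sigma> i) \<longleftrightarrow>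
        (\<forall>i\<in>I. 0 < i \<longrightarrow> ?P \<sigma> i)"
    proof (intro iffI ballI impI conjI)
      fix i
      assume *: "(\<forall>i\<in>{1..<a}. ?P \<sigma> i) \<and> (\<forall>i\<in>I. a < i \<and> i < n \<longrightarrow> ?P \<sigma> i)" and i: "i \<in> I" "0 < i"
      consider "i < a" | "a < i" using assms(2) i by (metis linorder_neqE_nat)
      then show "?P \<sigma> i" using * i I by cases auto
    qed (use assms(1) in auto)
    ultimately show ?thesis by blast
  qed
  have cols: "map snd ?Bs = map (map odd) ?Ps"
    using first by (simp add: blocks_eq_runs comp_def del: upt_Suc)
  have conc: "concat ?Ps = [1..<Suc n]"
    using upt_add_eq_append[of 1 "Suc a" "sum_list bs"] n by (simp add: concat_runs del: upt_Suc)
  show ?thesis unfolding gf_eq_sum_weight[OF cols conc] conds ..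
qed

section \<open>Connected components of \<open>I\<close> and assembly of the theorem\<close>

lemma interval_component:
  assumes "u \<le> v" "{u..v} \<subseteq> I" "Suc v \<notin> I" "u = 0 \<or> u - 1 \<notin> I"
  shows "{u..v} \<in> components I"
proof -
  have "J = {u..v}" if J: "interval_in I J" "{u..v} \<subseteq> J" for J
  proof -
    obtain a b where ab: "J \<subseteq> I" "a \<le> b" "J = {a..b}" using J(1) by (auto simp: interval_in_def)
    then have le: "a \<le> u" "v \<le> b" using J(2) assms(1) by (simp_all add: atLeastatMost_subset_iff)
    have "\<not> v < b"
    proof
      assume "v < b"
      then have "Suc v \<in> J" using le assms(1) ab(3) by auto
      then show False using ab(1) assms(3) by blast
    qed
    moreover have "\<not> a < u"
    proof
      assume "a < u"
      then have "u - 1 \<in> J" "u \<noteq> 0" using le assms(1) ab(3) by auto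
      then show False using ab(1) assms(4) by blast
    qed
    ultimately show ?thesis using le ab(3) by simp
  qed
  moreover have "interval_in I {u..v}" using assms by (auto simp: interval_in_def)
  ultimately show ?thesis by (simp add: components_def)
qed

lemma finite_components: "finite I \<Longrightarrow> finite (components I)"
  by (rule finite_subset[of _ "Pow I"]) (auto simp: components_def interval_in_def)

text \<open>A block of length \<open>b \<ge> 2\<close> comes from a component with
  \<open>b - 1\<close> elements, whose contribution is \<open>b div 2\<close>; a block of length
  \<open>1\<close> contributes \<open>0\<close>. Different blocks give different components, which
  yields the inequality. The hypothesis \<open>s \<notin> I\<close> makes the first interval maximal
  on the left.\<close>

lemma run_lengths_le_components:
  assumes "finite I" "run_lengths I s bs" "s \<notin> I"
  shows "(\<Sum>b\<leftarrow>bs. b div 2) \<le> (\<Sum>J | J \<in> components I \<and> J \<subseteq> {Suc s..}. (card J + 1) div 2)"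
  using assms(2,3)
proof (induction bs arbitrary: s)
  case (Cons b bs)
  let ?C = "\<lambda>s. {J \<in> components I. J \<subseteq> {Suc s..}}" and ?w = "\<lambda>J :: nat set. (card J + 1) div 2"
  have fin: "finite (?C s)" for s using finite_components[OF assms(1)] by simp
  have sub: "?C (s + b) \<subseteq> ?C s" by auto
  have IH: "(\<Sum>b\<leftarrow>bs. b div 2) \<le> sum ?w (?C (s + b))" using Cons by simp
  show ?case
  proof (cases "2 \<le> b")
    case True
    let ?J = "{Suc s..s + b - 1}"
    have "?J \<in> components I"
    proof (rule interval_component)
      have "?J = {Suc s..<s + b}" using True by auto
      then show "?J \<subseteq> I" using Cons.prems(1) by simp
    qed (use Cons.prems True in auto)
    moreover have "Suc s \<in> ?J" using True by simp
    ultimately have J: "?J \<in> ?C s" "?J \<notin> ?C (s + b)" using True by auto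
    have "b div 2 + (\<Sum>b\<leftarrow>bs. b div 2) \<le> ?w ?J + sum ?w (?C (s + b))"
      using IH True by simp
    also have "\<dots> = sum ?w (insert ?J (?C (s + b)))" using J(2) fin by simp
    also have "\<dots> \<le> sum ?w (?C s)" using sub J(1) fin by (intro sum_mono2) auto
    finally show ?thesis by simp
  next
    case False
    then have "b div 2 = 0" by simp
    then show ?thesis using IH sum_mono2[OF fin sub, of ?w] by simp
  qed
qed simp

text \<open>The component of \<open>0\<close> has as many elements as the leading block has
  positions, hence \<open>(a + 1) div 2\<close>, whereas every other block is one longer than its
  component.\<close>

lemma component_sum_ge:
  assumes "finite I" "run_lengths I a bs" "a \<notin> I" "{0..<a} \<subseteq> I"
  shows "(a + 1) div 2 + (\<Sum>b\<leftarrow>bs. b div 2) \<le> component_sum I"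
proof -
  let ?C = "{J \<in> components I. J \<subseteq> {Suc a..}}" and ?w = "\<lambda>J :: nat set. (card J + 1) div 2"
  have fin: "finite (components I)" using finite_components[OF assms(1)] .
  have le: "(\<Sum>b\<leftarrow>bs. b div 2) \<le> sum ?w ?C" using run_lengths_le_components[OF assms(1-3)] .
  show ?thesis
  proof (cases "a = 0")
    case True
    then show ?thesis
      using le sum_mono2[OF fin, of ?C ?w] by (simp add: component_sum_def)
  next
    case False
    let ?J = "{0..a - 1}"
    have eq: "?J = {0..<a}" using False by auto
    have "?J \<in> components I"
      by (rule interval_component) (use assms False eq in auto)
    then have "sum ?w (insert ?J ?C) \<le> component_sum I"
      unfolding component_sum_def using fin by (intro sum_mono2) auto
    moreover have "?J \<notin> ?C" by auto
    then have "sum ?w (insert ?J ?C) = ?w ?J + sum ?w ?C" using fin by (intro sum.insert) auto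
    ultimately have "?w ?J + sum ?w ?C \<le> component_sum I" by simp
    then show ?thesis using le eq by simp
  qed
qed

text \<open>Excluding \<open>a = 1\<close> leaves an empty leading block or
  \<open>{0, 1} \<subseteq> I\<close>. The bound \<open>m\<close> is free, so that a value computed
  for one set can serve another; enlarging it only moves factors of the product into
  \<open>M\<close>.\<close>

lemma divides_quotientD_poly:
  assumes "2 \<le> n" and I: "I \<subseteq> {0..n - 1}" and a: "{0..<a} \<subseteq> I" "a \<notin> I" "a \<noteq> 1"
    and bs: "run_lengths I a bs" "\<forall>b\<in>set bs. 0 < b" "a + sum_list bs = n"
    and m: "(a + 1) div 2 + (\<Sum>b\<leftarrow>bs. b div 2) \<le> m"
  shows "\<exists>M. quotientD_poly n I = M * (\<Prod>j = 2 * m + 2..n. factor j ^ 2)"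
proof (cases "2 * m + 2 \<le> n")
  case False
  then show ?thesis by (intro exI[of _ "quotientD_poly n I"]) simp
next
  case True
  let ?m = "(a + 1) div 2 + (\<Sum>b\<leftarrow>bs. b div 2)" and ?G = "gf (D True a # blocks (even a) bs)"
  let ?E = "if even a then 1 + (X ^ (a div 2))\<^sup>2 else (1 :: int poly)"
  have lt: "\<forall>i\<in>I. i < n" using I assms(1) by auto
  have asc: "(\<forall>i\<in>I. entryD \<sigma> i < entryD \<sigma> (i + 1)) \<longleftrightarrow>
      (0 \<in> I \<longrightarrow> - \<sigma> 2 < \<sigma> 1) \<and> (\<forall>i\<in>I. 0 < i \<longrightarrow> \<sigma> (int i) < \<sigma> (int i + 1))" for \<sigma>
    by (auto simp: entryD_def add.commute)
  have "{2 * ?m + 2..n} = {2 * ?m + 2..2 * m + 1} \<union> {2 * m + 2..n}"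
    using m True by auto
  then have split: "(\<Prod>j = 2 * ?m + 2..n. factor j ^ 2) =
      (\<Prod>j = 2 * ?m + 2..2 * m + 1. factor j ^ 2) * (\<Prod>j = 2 * m + 2..n. factor j ^ 2)"
    by (simp only:) (rule prod.union_disjoint; auto)
  have "2 * ?m + 2 \<le> 2 * m + 2" using m by (intro add_le_mono1 mult_le_mono2)
  also note True
  finally have "2 * ?m + 2 \<le> a + sum_list bs" unfolding bs(3) .
  from gf_divisible[OF bs(2) this, of True] obtain M where
    M: "?G = ?E * M * (\<Prod>j = 2 * ?m + 2..n. factor j ^ 2)"
    using bs(3) by auto
  have sum: "?G = (\<Sum>\<sigma> | \<sigma> \<in> signed_perms n \<and> (0 < a \<longrightarrow> 0 < \<sigma> 1) \<and>
      (\<forall>i\<in>I. 0 < i \<longrightarrow> \<sigma> (int i) < \<sigma> (int i + 1)). weight n \<sigma>)"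
    using a bs lt by (intro gf_eq_sum_ascents) auto
  show ?thesis
  proof (cases "a = 0")
    case True
    then have "?G = ordered_sum n I"
      using a unfolding sum ordered_sum_def ordered_def asc by simp
    \<comment> \<open>For \<open>a = 0\<close> the factor \<open>?E\<close> equals \<open>2\<close>
      and cancels against the factor of \<open>quotientD_poly_eq\<close>, so the cofactor stays
      integral.\<close>
    then have "2 * quotientD_poly n I = 2 * (M * (\<Prod>j = 2 * ?m + 2..n. factor j ^ 2))"
      using quotientD_poly_eq[OF assms(1) I] M True by (simp add: mult.assoc)
    then show ?thesis unfolding split by (simp only: mult_cancel_left) (auto simp: mult.assoc[symmetric])
  next
    case False
    then have "{0, 1} \<subseteq> I" using a by auto
    moreover have "{\<sigma>. \<sigma> \<in> ordered n I \<and> 0 < \<sigma> 1} = {\<sigma>. \<sigma> \<in> signed_perms n \<and> (0 < a \<longrightarrow> 0 < \<sigma> 1) \<and>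
        (\<forall>i\<in>I. 0 < i \<longrightarrow> \<sigma> (int i) < \<sigma> (int i + 1))}"
    proof -
      \<comment> \<open>The condition at \<open>0\<close> follows from
        \<open>0 < \<sigma> 1 < \<sigma> 2\<close>.\<close>
      have "- \<sigma> 2 < \<sigma> 1" if "0 < \<sigma> 1" "\<forall>i\<in>I. 0 < i \<longrightarrow> \<sigma> (int i) < \<sigma> (int i + 1)" for \<sigma> :: "int \<Rightarrow> int"
        using that \<open>{0, 1} \<subseteq> I\<close> by (auto dest!: bspec[of _ _ 1])
      then show ?thesis unfolding ordered_def asc using False by auto
    qed
    ultimately have "ordered_sum n I = 2 * ?G"
      unfolding sum using ordered_sum_positive[OF assms(1)] by simp
    then have "quotientD_poly n I = ?G" using quotientD_poly_eq[OF assms(1) I] by simp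
    then show ?thesis unfolding M split by (auto simp: mult.assoc[symmetric])
  qed
qed

theorem corollary5p12:
  fixes n :: nat and I :: "nat set"
  assumes "n \<ge> 3" and "I \<subseteq> {0..n - 1}"
  shows "\<exists>M :: int poly.
    quotientD_poly n I =
      M * (\<Prod>j = 2 * component_sum I + 2..n. (1 + monom ((- 1) ^ (j - 1)) (j div 2)) ^ 2)"
proof -
  have n: "2 \<le> n" using assms(1) by simp
  have lt: "\<forall>i\<in>I. i < n" using assms by auto
  have fin: "finite I" using assms(2) finite_subset by blast
  \<comment> \<open>The elements of \<open>I\<close> below \<open>a\<close> form the component of
    \<open>0\<close>, so \<open>a\<close> is its size.\<close>
  define a where "a = (LEAST i. i \<notin> I)"
  have "n \<notin> I" using lt by blast
  then have aI: "a \<notin> I" and an: "a \<le> n" unfolding a_def by (rule LeastI, rule Least_le)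
  have below: "{0..<a} \<subseteq> I" using not_less_Least unfolding a_def by fastforce
  obtain bs where bs: "\<forall>b\<in>set bs. 0 < b" "a + sum_list bs = n" "run_lengths I a bs"
    using run_lengths_exist[OF lt an] by blast
  have m: "(a + 1) div 2 + (\<Sum>b\<leftarrow>bs. b div 2) \<le> component_sum I"
    using component_sum_ge[OF fin bs(3) aI below] .
  show ?thesis
  proof (cases "a = 1")
    case False
    then show ?thesis
      using divides_quotientD_poly[OF n assms(2) below aI False bs(3,1,2) m] by (simp add: factor_def)
  next
    case True
    \<comment> \<open>Now \<open>0 \<in> I\<close> and \<open>1 \<notin> I\<close>. Exchanging them
      removes the condition at \<open>0\<close> and joins position \<open>1\<close> to the block
      that starts at position \<open>2\<close>.\<close>
    define I' where "I' = transpose 0 1 ` I"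
    have I': "I' = insert 1 (I - {0})"
      using below aI True unfolding I'_def by (auto simp: transpose_def image_iff)
    have sub: "I' \<subseteq> {0..n - 1}" using assms unfolding I' by auto
    have "quotientD_poly n I = quotientD_poly n I'"
    proof -
      have "2 * quotientD_poly n I = 2 * quotientD_poly n I'"
        using ordered_sum_transpose[OF n, of I] quotientD_poly_eq[OF n assms(2)] quotientD_poly_eq[OF n sub]
        by (simp add: I'_def)
      then show ?thesis by simp
    qed
    moreover have "\<exists>M. quotientD_poly n I' = M * (\<Prod>j = 2 * component_sum I + 2..n. factor j ^ 2)"
    proof -
      obtain b bs' where b: "bs = b # bs'" using bs(2) True assms(1) by (cases bs) auto
      have "run_lengths I' (Suc b) bs' \<longleftrightarrow> run_lengths I (Suc b) bs'"
        using bs(1) b by (intro run_lengths_cong) (auto simp: I')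
      moreover have "{Suc 0..<Suc b} \<subseteq> I'" using bs(3) b True by (auto simp: I')
      moreover have "Suc b \<notin> I'" using bs(1,3) b True by (auto simp: I')
      ultimately have "run_lengths I' 0 (Suc b # bs')" using bs(3) b True by simp
      \<comment> \<open>The joined block has length \<open>Suc b\<close>, and
        \<open>Suc b div 2 \<le> 1 + b div 2\<close>, so the bound obtained for \<open>I\<close>
        also serves \<open>I'\<close>.\<close>
      moreover have "Suc b div 2 + (\<Sum>b\<leftarrow>bs'. b div 2) \<le> component_sum I" using m b True by simp
      moreover have "0 \<notin> I'" "\<forall>b\<in>set (Suc b # bs'). 0 < b" "0 + sum_list (Suc b # bs') = n"
        using bs b True by (auto simp: I')
      ultimately show ?thesis
        by (intro divides_quotientD_poly[OF n sub, of 0 "Suc b # bs'"]) auto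
    qed
    ultimately show ?thesis by (simp add: factor_def)
  qed
qed

end
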